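(* Let $\alpha_{k+1}>0$, $k=0,1,\ldots$, be a sequence of step sizes. Let $\Omega\subset\mathbb{R}^n$, $n\ge1$, be an open, bounded Lipschitz domain, let $f\in L^\infty(\Omega)$, let $\phi\in\mathcal{O}$, and let $g\in H^1(\Omega)\cap C(\overline\Omega)$ satisfy $\min_{\partial\Omega}(g-\phi)>0$. Fix $\psi^0\in H^1(\Omega)\cap L^\infty(\Omega)$, set $u^0=\phi+\exp\psi^0$, and consider the sequence of functions $u^{k+1}\in H^1_g(\Omega)$, $\psi^{k+1}\in L^\infty(\Omega)$, $k=0,1,\ldots$, solving $$\begin{aligned}(\alpha_{k+1}\nabla u^{k+1},\nabla v)+(\psi^{k+1},v)&=(\alpha_{k+1}f+\psi^k,v)&&\text{for all }v\in H^1_0(\Omega),\\(u^{k+1},w)-(\exp\psi^{k+1},w)&=(\phi,w)&&\text{for all }w\in L^2(\Omega).\end{aligned}$$ Then the Dirichlet energy of the primal iterates is monotonically non-increasing: $$E(u^{k+1})\le E(u^k),\qquad k=0,1,\ldots$$ Let $$u^*=\operatorname*{arg\,min}_{u\in H^1(\Omega)}E(u)\quad\text{subject to }u\ge\phi\text{ in }\Omega\text{ and }u=g\text{ on }\partial\Omega,$$ let $\lambda^{k+1}=(\psi^k-\psi^{k+1})/\alpha_{k+1}$ for $k=0,1,\ldots$, and let $\lambda^*=-\Delta u^*-f\in H^{-1}(\Omega)$ (the Lagrange multiplier). If $\sum_{j=1}^k\alpha_j\to\infty$ as $k\to\infty$, then $u^k\to u^*$ in $H^1(\Omega)$, and furthermore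 $\lambda^k\to\lambda^*$ strongly in $H^{-1}(\Omega)$. In fact, the optimization errors in $u^k$ and $\lambda^k$ are equal and converge at the following rate determined by the step sizes: for $k=1,2,\ldots$, $$\frac12\|\lambda^*-\lambda^k\|_{H^{-1}(\Omega)}^2=\frac12\|\nabla u^*-\nabla u^k\|_{L^2(\Omega)}^2\le\frac{D(u^*-\phi,u^0-\phi)}{\sum_{j=1}^k\alpha_j}.$$
   Context: $H^1_g(\Omega)=g+H^1_0(\Omega)$. $\mathcal{O}=\{\phi\in H^1(\Omega)\cap C(\overline\Omega)\mid\Delta\phi\in L^\infty(\Omega)\}$ ($\Delta$ in the distributional sense). $E(v)=\frac12\int_\Omega|\nabla v|^2\,\mathrm{d}x-\int_\Omega fv\,\mathrm{d}x$ is the Dirichlet energy. For $a\ge0$ a.e. and $b\in L^\infty(\Omega)$ with $\operatorname{ess\,inf}b>0$, $D(a,b)=\int_\Omega a\ln(a/b)-a+b\,\mathrm{d}x$, with $0\ln0:=0$. $(\cdot,\cdot)$ is the $L^2(\Omega)$ inner product. $\|\lambda\|_{H^{-1}(\Omega)}=\sup_{0\ne w\in H^1_0(\Omega)}\langle\lambda,w\rangle/\|\nabla w\|_{L^2(\Omega)}$.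
   Formalization: The energy inequality at k=0 is asserted only when u^0 lies in H^1_g(Ω): without u^0=g on the boundary it fails, e.g. Ω=(0,1), φ=f=0, g=1+x, ψ^0=0, where E(u^0)=0 but E(u^1)≥1/2. For k≥1 it is unconditional. *)

theory Defs
  imports "HOL-Analysis.Analysis"
begin

text \<open>
  Functions on \<open>\<Omega>\<close> are represented by total functions of which only the values on \<open>\<Omega>\<close> (for
  functions in \<open>C(closure \<Omega>)\<close>, the values on the closure) matter. Elements of Lebesgue and Sobolev
  spaces are representatives of their almost-everywhere classes.
\<close>


subsection \<open>Lipschitz domains\<close>

text \<open>
  Near each boundary point, \<open>\<Omega>\<close> is the strict epigraph, in some unit direction \<open>e\<close>, of a Lipschitz
  function of the coordinates orthogonal to \<open>e\<close>. Connectedness is not required.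
\<close>

definition bounded_lipschitz_domain :: "'a::euclidean_space set \<Rightarrow> bool" where
  "bounded_lipschitz_domain \<Omega> \<longleftrightarrow>
     open \<Omega> \<and> bounded \<Omega> \<and> \<Omega> \<noteq> {} \<and>
     (\<forall>p\<in>frontier \<Omega>. \<exists>e r L \<gamma>. norm e = 1 \<and> r > 0 \<and> L-lipschitz_on {y. y \<bullet> e = 0} (\<gamma> :: 'a \<Rightarrow> real) \<and>
        \<Omega> \<inter> ball p r = {x \<in> ball p r. x \<bullet> e > \<gamma> (x - (x \<bullet> e) *\<^sub>R e)})"


subsection \<open>Lebesgue spaces\<close>

definition L2_space :: "'a::euclidean_space set \<Rightarrow> ('a \<Rightarrow> 'b::euclidean_space) set" where
  "L2_space \<Omega> = {u \<in> borel_measurable (lebesgue_on \<Omega>). integrable (lebesgue_on \<Omega>) (\<lambda>x. (norm (u x))\<^sup>2)}"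

definition L2_inner :: "'a::euclidean_space set \<Rightarrow> ('a \<Rightarrow> 'b::euclidean_space) \<Rightarrow> ('a \<Rightarrow> 'b) \<Rightarrow> real" where
  "L2_inner \<Omega> u v = (LINT x|lebesgue_on \<Omega>. u x \<bullet> v x)"

definition L2_norm :: "'a::euclidean_space set \<Rightarrow> ('a \<Rightarrow> 'b::euclidean_space) \<Rightarrow> real" where
  "L2_norm \<Omega> u = sqrt (L2_inner \<Omega> u u)"

definition Linf_space :: "'a::euclidean_space set \<Rightarrow> ('a \<Rightarrow> real) set" where
  "Linf_space \<Omega> = {u \<in> borel_measurable (lebesgue_on \<Omega>). \<exists>C. AE x in lebesgue_on \<Omega>. \<bar>u x\<bar> \<le> C}"


subsection \<open>Test functions and weak derivatives\<close>

definition partial_deriv :: "'a::euclidean_space \<Rightarrow> ('a \<Rightarrow> real) \<Rightarrow> 'a \<Rightarrow> real" where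
  "partial_deriv i f x = frechet_derivative f (at x) i"

text \<open>
  \<open>partial_deriv\<close> is meaningful only where \<open>f\<close> is differentiable; the next definition asks for this at
  every order, so it says that \<open>f\<close> is \<open>C\<^sup>\<infinity>\<close>.
\<close>

definition smooth_fun :: "('a::euclidean_space \<Rightarrow> real) \<Rightarrow> bool" where
  "smooth_fun f \<longleftrightarrow> (\<forall>is \<in> lists Basis. foldr partial_deriv is f differentiable_on UNIV)"

definition test_funs :: "'a::euclidean_space set \<Rightarrow> ('a \<Rightarrow> real) set" where
  "test_funs \<Omega> = {\<eta>. smooth_fun \<eta> \<and> compact (closure {x. \<eta> x \<noteq> 0}) \<and> closure {x. \<eta> x \<noteq> 0} \<subseteq> \<Omega>}"

definition is_weak_grad :: "'a::euclidean_space set \<Rightarrow> ('a \<Rightarrow> real) \<Rightarrow> ('a \<Rightarrow> 'a) \<Rightarrow> bool" where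
  "is_weak_grad \<Omega> u G \<longleftrightarrow> (\<forall>\<eta>\<in>test_funs \<Omega>. \<forall>i\<in>Basis.
     (LINT x|lebesgue_on \<Omega>. u x * partial_deriv i \<eta> x) = - (LINT x|lebesgue_on \<Omega>. (G x \<bullet> i) * \<eta> x))"

text \<open>For \<open>u\<close> in \<open>H\<^sup>1\<close> the weak gradient is unique up to null sets.\<close>

definition weak_grad :: "'a::euclidean_space set \<Rightarrow> ('a \<Rightarrow> real) \<Rightarrow> 'a \<Rightarrow> 'a" where
  "weak_grad \<Omega> u = (SOME G. G \<in> L2_space \<Omega> \<and> is_weak_grad \<Omega> u G)"

definition is_distr_laplacian :: "'a::euclidean_space set \<Rightarrow> ('a \<Rightarrow> real) \<Rightarrow> ('a \<Rightarrow> real) \<Rightarrow> bool" where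
  "is_distr_laplacian \<Omega> u h \<longleftrightarrow> (\<forall>\<eta>\<in>test_funs \<Omega>.
     (LINT x|lebesgue_on \<Omega>. u x * (\<Sum>i\<in>Basis. partial_deriv i (partial_deriv i \<eta>) x)) =
     (LINT x|lebesgue_on \<Omega>. h x * \<eta> x))"


subsection \<open>Sobolev spaces\<close>

definition H1 :: "'a::euclidean_space set \<Rightarrow> ('a \<Rightarrow> real) set" where
  "H1 \<Omega> = {u \<in> L2_space \<Omega>. \<exists>G \<in> L2_space \<Omega>. is_weak_grad \<Omega> u G}"

definition H1_norm :: "'a::euclidean_space set \<Rightarrow> ('a \<Rightarrow> real) \<Rightarrow> real" where
  "H1_norm \<Omega> u = sqrt ((L2_norm \<Omega> u)\<^sup>2 + (L2_norm \<Omega> (weak_grad \<Omega> u))\<^sup>2)"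

definition H10 :: "'a::euclidean_space set \<Rightarrow> ('a \<Rightarrow> real) set" where
  "H10 \<Omega> = {u \<in> H1 \<Omega>. \<exists>\<eta> :: nat \<Rightarrow> 'a \<Rightarrow> real. range \<eta> \<subseteq> test_funs \<Omega> \<and>
              (\<lambda>n. H1_norm \<Omega> (\<lambda>x. u x - \<eta> n x)) \<longlonglongrightarrow> 0}"

text \<open>The affine space \<open>g + H\<^sup>1\<^sub>0\<close>.\<close>

definition H1g :: "'a::euclidean_space set \<Rightarrow> ('a \<Rightarrow> real) \<Rightarrow> ('a \<Rightarrow> real) set" where
  "H1g \<Omega> g = {u \<in> H1 \<Omega>. (\<lambda>x. u x - g x) \<in> H10 \<Omega>}"

definition obstacles :: "'a::euclidean_space set \<Rightarrow> ('a \<Rightarrow> real) set" where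
  "obstacles \<Omega> = {\<phi> \<in> H1 \<Omega>. continuous_on (closure \<Omega>) \<phi> \<and>
                   (\<exists>h \<in> Linf_space \<Omega>. is_distr_laplacian \<Omega> \<phi> h)}"


subsection \<open>The dual space of \<open>H\<^sup>1\<^sub>0\<close>\<close>

definition Hm1 :: "'a::euclidean_space set \<Rightarrow> (('a \<Rightarrow> real) \<Rightarrow> real) set" where
  "Hm1 \<Omega> = {\<Lambda>.
     (\<forall>v\<in>H10 \<Omega>. \<forall>w\<in>H10 \<Omega>. \<Lambda> (\<lambda>x. v x + w x) = \<Lambda> v + \<Lambda> w) \<and>
     (\<forall>c. \<forall>w\<in>H10 \<Omega>. \<Lambda> (\<lambda>x. c * w x) = c * \<Lambda> w) \<and>
     (\<exists>C. \<forall>w\<in>H10 \<Omega>. \<bar>\<Lambda> w\<bar> \<le> C * H1_norm \<Omega> w)}"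

definition Hm1_norm :: "'a::euclidean_space set \<Rightarrow> (('a \<Rightarrow> real) \<Rightarrow> real) \<Rightarrow> real" where
  "Hm1_norm \<Omega> \<Lambda> = (SUP w \<in> {w \<in> H10 \<Omega>. \<not> (AE x in lebesgue_on \<Omega>. w x = 0)}.
                        \<Lambda> w / L2_norm \<Omega> (weak_grad \<Omega> w))"

text \<open>
  The embedding of \<open>L\<^sup>2\<close> into \<open>H\<^sup>-\<^sup>1\<close>, and \<open>-\<Delta>u\<close> for \<open>u\<close> in \<open>H\<^sup>1\<close>: the distributional Laplacian of such
  a \<open>u\<close>, extended by continuity from test functions to \<open>H\<^sup>1\<^sub>0\<close>.
\<close>

definition L2_functional :: "'a::euclidean_space set \<Rightarrow> ('a \<Rightarrow> real) \<Rightarrow> ('a \<Rightarrow> real) \<Rightarrow> real" where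
  "L2_functional \<Omega> h = (\<lambda>w. L2_inner \<Omega> h w)"

definition neg_laplacian :: "'a::euclidean_space set \<Rightarrow> ('a \<Rightarrow> real) \<Rightarrow> ('a \<Rightarrow> real) \<Rightarrow> real" where
  "neg_laplacian \<Omega> u = (\<lambda>w. L2_inner \<Omega> (weak_grad \<Omega> u) (weak_grad \<Omega> w))"


subsection \<open>Dirichlet energy, admissible set and entropy divergence\<close>

definition dirichlet_energy :: "'a::euclidean_space set \<Rightarrow> ('a \<Rightarrow> real) \<Rightarrow> ('a \<Rightarrow> real) \<Rightarrow> real" where
  "dirichlet_energy \<Omega> f v =
     1/2 * (LINT x|lebesgue_on \<Omega>. (norm (weak_grad \<Omega> v x))\<^sup>2) - (LINT x|lebesgue_on \<Omega>. f x * v x)"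

definition admissible :: "'a::euclidean_space set \<Rightarrow> ('a \<Rightarrow> real) \<Rightarrow> ('a \<Rightarrow> real) \<Rightarrow> ('a \<Rightarrow> real) set" where
  "admissible \<Omega> \<phi> g = {v \<in> H1g \<Omega> g. AE x in lebesgue_on \<Omega>. v x \<ge> \<phi> x}"

text \<open>Where \<open>a x = 0\<close> the product below vanishes, which is the convention \<open>0 ln 0 = 0\<close>.\<close>

definition entropy_div :: "'a::euclidean_space set \<Rightarrow> ('a \<Rightarrow> real) \<Rightarrow> ('a \<Rightarrow> real) \<Rightarrow> real" where
  "entropy_div \<Omega> a b = (LINT x|lebesgue_on \<Omega>. a x * ln (a x / b x) - a x + b x)"

end

theory Submission
  imports Defs
begin

text \<open>
  Write \<open>\<phi> + e\<^sup>\<psi>\<close> for the iterates: the second equation of a step says exactly that the new iterate has this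
  form almost everywhere. The first equation says that \<open>\<alpha> (-\<Delta>u' - f) = \<psi> - \<psi>'\<close> on \<open>H\<^sup>1\<^sub>0\<close>, where \<open>u\<close>, \<open>\<psi>\<close> are
  the old and \<open>u'\<close>, \<open>\<psi>'\<close> the new iterates. This is a step of mirror descent for the Dirichlet energy with
  the entropy as mirror map, and the proof is the classical one for that method.

  Testing with \<open>u' - u = e\<^sup>\<psi>\<^sup>' - e\<^sup>\<psi>\<close> and using that \<open>exp\<close> is increasing shows that the energy decreases
  (\<open>proximal_step_energy_decrease\<close>). Testing with \<open>u' - v\<close> for an admissible \<open>v\<close>, convexity of the energy and
  the three-point identity of the entropy divergence (\<open>entropy_three_point\<close>) bound \<open>\<alpha> (E u' - E v)\<close> by
  \<open>D(v - \<phi>, e\<^sup>\<psi>) - D(v - \<phi>, e\<^sup>\<psi>\<^sup>')\<close> (\<open>proximal_step_energy_gap\<close>). With \<open>v = u\<^sup>*\<close> these bounds telescope, and by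
  monotonicity the last energy gap is at most their weighted mean (\<open>weighted_gap_telescope\<close>). Finally the
  variational inequality of the obstacle problem bounds \<open>\<parallel>\<nabla>(u\<^sup>k - u\<^sup>*)\<parallel>\<^sup>2 / 2\<close> by the energy gap
  (\<open>grad_error_le_energy_gap\<close>).

  The two errors agree since \<open>\<lambda>\<^sup>* - \<lambda>\<^sup>k = -\<Delta>(u\<^sup>* - u\<^sup>k)\<close> and \<open>-\<Delta>\<close> is an isometry from \<open>H\<^sup>1\<^sub>0\<close>, normed by the gradient,
  to its dual (\<open>Hm1_norm_eq_grad_norm\<close>). Convergence in \<open>H\<^sup>1\<close> follows from that of the gradients by the
  Poincare inequality (\<open>poincare_H10\<close>).

  All of this calculates with weak gradients, which are choices that are determined only up to null sets.
  Their linearity rests on uniqueness, hence on the fundamental lemma of the calculus of variations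
  (\<open>fundamental_lemma_variations\<close>); that in turn requires a supply of smooth functions with compact
  support (\<open>box_bump_test_funs\<close>). That classical gradients of test functions are weak gradients is
  integration by parts (\<open>test_fun_ibp\<close>).
\<close>

section \<open>The semi-inner product of square-integrable functions\<close>

lemma L2_inner_integrable:
  fixes u v :: "'a::euclidean_space \<Rightarrow> 'b::euclidean_space"
  assumes "u \<in> L2_space \<Omega>" "v \<in> L2_space \<Omega>"
  shows "integrable (lebesgue_on \<Omega>) (\<lambda>x. u x \<bullet> v x)"
proof (rule Bochner_Integration.integrable_bound)
  show "integrable (lebesgue_on \<Omega>) (\<lambda>x. (norm (u x))\<^sup>2 + (norm (v x))\<^sup>2)"
    using assms by (auto simp: L2_space_def)
  show "(\<lambda>x. u x \<bullet> v x) \<in> borel_measurable (lebesgue_on \<Omega>)"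
    using assms by (auto simp: L2_space_def)
  have "\<bar>a \<bullet> b\<bar> \<le> (norm a)\<^sup>2 + (norm b)\<^sup>2" for a b :: 'b
  proof -
    have "\<bar>a \<bullet> b\<bar> \<le> norm a * norm b" by (rule Cauchy_Schwarz_ineq2)
    also have "\<dots> \<le> (norm a)\<^sup>2 + (norm b)\<^sup>2"
      using sum_squares_bound[of "norm a" "norm b"] mult_nonneg_nonneg[OF norm_ge_zero norm_ge_zero, of a b]
      unfolding mult.assoc by linarith
    finally show ?thesis .
  qed
  then show "AE x in lebesgue_on \<Omega>. norm (u x \<bullet> v x) \<le> norm ((norm (u x))\<^sup>2 + (norm (v x))\<^sup>2)"
    by auto
qed

lemma L2_space_zero: "(\<lambda>x. 0) \<in> L2_space \<Omega>"
  by (simp add: L2_space_def)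

lemma L2_space_add:
  fixes u v :: "'a::euclidean_space \<Rightarrow> 'b::euclidean_space"
  assumes "u \<in> L2_space \<Omega>" "v \<in> L2_space \<Omega>"
  shows "(\<lambda>x. u x + v x) \<in> L2_space \<Omega>"
proof -
  have "(norm (u x + v x))\<^sup>2 = (norm (u x))\<^sup>2 + 2 * (u x \<bullet> v x) + (norm (v x))\<^sup>2" for x
    by (simp add: power2_norm_eq_inner inner_add inner_commute)
  then show ?thesis
    using assms L2_inner_integrable[OF assms] by (auto simp: L2_space_def)
qed

lemma L2_space_scaleR:
  fixes u :: "'a::euclidean_space \<Rightarrow> 'b::euclidean_space"
  assumes "u \<in> L2_space \<Omega>"
  shows "(\<lambda>x. c *\<^sub>R u x) \<in> L2_space \<Omega>"
  using assms by (auto simp: L2_space_def power_mult_distrib)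

lemma L2_space_mult:
  fixes u :: "'a::euclidean_space \<Rightarrow> real"
  shows "u \<in> L2_space \<Omega> \<Longrightarrow> (\<lambda>x. c * u x) \<in> L2_space \<Omega>"
  using L2_space_scaleR[of u \<Omega> c] by simp

lemma L2_space_diff:
  fixes u v :: "'a::euclidean_space \<Rightarrow> 'b::euclidean_space"
  assumes "u \<in> L2_space \<Omega>" "v \<in> L2_space \<Omega>"
  shows "(\<lambda>x. u x - v x) \<in> L2_space \<Omega>"
  using L2_space_add[OF assms(1) L2_space_scaleR[OF assms(2), of "-1"]] by simp

lemma L2_inner_commute: "L2_inner \<Omega> u v = L2_inner \<Omega> v u"
  by (simp add: L2_inner_def inner_commute)

lemma L2_inner_add_left:
  assumes "u \<in> L2_space \<Omega>" "v \<in> L2_space \<Omega>" "w \<in> L2_space \<Omega>"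
  shows "L2_inner \<Omega> (\<lambda>x. u x + v x) w = L2_inner \<Omega> u w + L2_inner \<Omega> v w"
  using assms by (simp add: L2_inner_def inner_add_left L2_inner_integrable)

lemma L2_inner_diff_left:
  assumes "u \<in> L2_space \<Omega>" "v \<in> L2_space \<Omega>" "w \<in> L2_space \<Omega>"
  shows "L2_inner \<Omega> (\<lambda>x. u x - v x) w = L2_inner \<Omega> u w - L2_inner \<Omega> v w"
  using assms by (simp add: L2_inner_def inner_diff_left L2_inner_integrable)

lemma L2_inner_scaleR_left: "L2_inner \<Omega> (\<lambda>x. c *\<^sub>R u x) w = c * L2_inner \<Omega> u w"
  by (simp add: L2_inner_def)

lemma L2_inner_mult_left:
  fixes u :: "'a::euclidean_space \<Rightarrow> real"
  shows "L2_inner \<Omega> (\<lambda>x. c * u x) w = c * L2_inner \<Omega> u w"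
  using L2_inner_scaleR_left[of \<Omega> c u w] by simp

lemma L2_inner_add_right:
  assumes "u \<in> L2_space \<Omega>" "v \<in> L2_space \<Omega>" "w \<in> L2_space \<Omega>"
  shows "L2_inner \<Omega> w (\<lambda>x. u x + v x) = L2_inner \<Omega> w u + L2_inner \<Omega> w v"
  using L2_inner_add_left[OF assms] by (simp add: L2_inner_commute)

lemma L2_inner_diff_right:
  assumes "u \<in> L2_space \<Omega>" "v \<in> L2_space \<Omega>" "w \<in> L2_space \<Omega>"
  shows "L2_inner \<Omega> w (\<lambda>x. u x - v x) = L2_inner \<Omega> w u - L2_inner \<Omega> w v"
  using L2_inner_diff_left[OF assms] by (simp add: L2_inner_commute)

lemma L2_inner_scaleR_right: "L2_inner \<Omega> w (\<lambda>x. c *\<^sub>R u x) = c * L2_inner \<Omega> w u"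
  by (simp add: L2_inner_def)

lemma L2_inner_mult_right:
  fixes u :: "'a::euclidean_space \<Rightarrow> real"
  shows "L2_inner \<Omega> w (\<lambda>x. c * u x) = c * L2_inner \<Omega> w u"
  using L2_inner_scaleR_right[of \<Omega> w c u] by simp

lemma L2_inner_cong:
  fixes u u' v v' :: "'a::euclidean_space \<Rightarrow> 'b::euclidean_space"
  assumes "u \<in> L2_space \<Omega>" "u' \<in> L2_space \<Omega>" "v \<in> L2_space \<Omega>" "v' \<in> L2_space \<Omega>"
    and "AE x in lebesgue_on \<Omega>. u x = u' x" "AE x in lebesgue_on \<Omega>. v x = v' x"
  shows "L2_inner \<Omega> u v = L2_inner \<Omega> u' v'"
  unfolding L2_inner_def
proof (rule integral_cong_AE)
  show "AE x in lebesgue_on \<Omega>. u x \<bullet> v x = u' x \<bullet> v' x"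
    using assms(5,6) by eventually_elim simp
qed (use assms in \<open>auto simp: L2_space_def\<close>)

lemma L2_inner_self_nonneg: "0 \<le> L2_inner \<Omega> u u"
  by (simp add: L2_inner_def)

lemma L2_norm_nonneg: "0 \<le> L2_norm \<Omega> u"
  by (simp add: L2_norm_def L2_inner_self_nonneg)

lemma L2_norm_square: "(L2_norm \<Omega> u)\<^sup>2 = L2_inner \<Omega> u u"
  by (simp add: L2_norm_def L2_inner_self_nonneg)

lemma L2_norm_cong:
  assumes "u \<in> L2_space \<Omega>" "u' \<in> L2_space \<Omega>" "AE x in lebesgue_on \<Omega>. u x = u' x"
  shows "L2_norm \<Omega> u = L2_norm \<Omega> u'"
  unfolding L2_norm_def using L2_inner_cong[OF assms(1,2,1,2,3,3)] by simp

lemma L2_norm_mono: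
  fixes u :: "'a::euclidean_space \<Rightarrow> 'b::euclidean_space" and v :: "'a \<Rightarrow> 'c::euclidean_space"
  assumes u: "u \<in> L2_space \<Omega>" and v: "v \<in> L2_space \<Omega>"
    and le: "AE x in lebesgue_on \<Omega>. norm (u x) \<le> norm (v x)"
  shows "L2_norm \<Omega> u \<le> L2_norm \<Omega> v"
proof -
  have "L2_inner \<Omega> u u \<le> L2_inner \<Omega> v v"
    unfolding L2_inner_def
  proof (rule integral_mono_AE[OF L2_inner_integrable[OF u u] L2_inner_integrable[OF v v]])
    show "AE x in lebesgue_on \<Omega>. u x \<bullet> u x \<le> v x \<bullet> v x"
      using le by eventually_elim (simp add: dot_square_norm power_mono)
  qed
  then show ?thesis unfolding L2_norm_def by (rule real_sqrt_le_mono)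
qed

lemma L2_norm_minus_commute: "L2_norm \<Omega> (\<lambda>x. u x - v x) = L2_norm \<Omega> (\<lambda>x. v x - u x)"
  unfolding L2_norm_def L2_inner_def by (simp add: dot_square_norm norm_minus_commute)

lemma L2_norm_scaleR: "L2_norm \<Omega> (\<lambda>x. c *\<^sub>R u x) = \<bar>c\<bar> * L2_norm \<Omega> u"
proof -
  have "L2_inner \<Omega> (\<lambda>x. c *\<^sub>R u x) (\<lambda>x. c *\<^sub>R u x) = c\<^sup>2 * L2_inner \<Omega> u u"
    by (simp add: L2_inner_scaleR_left L2_inner_scaleR_right power2_eq_square)
  then show ?thesis by (simp add: L2_norm_def real_sqrt_mult)
qed

lemma L2_inner_add_self:
  assumes "u \<in> L2_space \<Omega>" "v \<in> L2_space \<Omega>"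
  shows "L2_inner \<Omega> (\<lambda>x. u x + v x) (\<lambda>x. u x + v x)
           = L2_inner \<Omega> u u + 2 * L2_inner \<Omega> u v + L2_inner \<Omega> v v"
  using assms L2_space_add[OF assms]
  by (simp add: L2_inner_add_left L2_inner_add_right L2_inner_commute[of \<Omega> v u])

text \<open>The polynomial \<open>t \<mapsto> \<parallel>u + t v\<parallel>\<^sup>2\<close> is nonnegative. Its discriminant gives the inequality, unless
  \<open>\<parallel>v\<parallel> = 0\<close>; then it is affine in \<open>t\<close>, so its slope \<open>2 (u, v)\<close> vanishes.\<close>

lemma L2_Cauchy_Schwarz:
  assumes "u \<in> L2_space \<Omega>" "v \<in> L2_space \<Omega>"
  shows "\<bar>L2_inner \<Omega> u v\<bar> \<le> L2_norm \<Omega> u * L2_norm \<Omega> v"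
proof -
  let ?a = "L2_inner \<Omega> u u" and ?b = "L2_inner \<Omega> u v" and ?c = "L2_inner \<Omega> v v"
  have pos: "0 \<le> ?a + 2 * t * ?b + t\<^sup>2 * ?c" for t
  proof -
    have "0 \<le> L2_inner \<Omega> (\<lambda>x. u x + t *\<^sub>R v x) (\<lambda>x. u x + t *\<^sub>R v x)"
      by (rule L2_inner_self_nonneg)
    also have "\<dots> = ?a + 2 * t * ?b + t\<^sup>2 * ?c"
      using L2_inner_add_self[OF assms(1) L2_space_scaleR[OF assms(2), of t]]
      by (simp add: L2_inner_scaleR_left L2_inner_scaleR_right power2_eq_square)
    finally show ?thesis .
  qed
  have "?b\<^sup>2 \<le> ?a * ?c"
  proof (cases "?c = 0")
    case True
    have "?b = 0"
    proof (rule ccontr)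
      assume "?b \<noteq> 0"
      moreover have "0 \<le> ?a + 2 * (- (?a + 1) / ?b) * ?b" using pos[of "- (?a + 1) / ?b"] True by simp
      ultimately have "0 \<le> ?a - 2 * (?a + 1)" by simp
      then show False using L2_inner_self_nonneg[of \<Omega> u] by simp
    qed
    then show ?thesis using True by simp
  next
    case False
    then have c: "?c > 0" using L2_inner_self_nonneg[of \<Omega> v] by simp
    have "0 \<le> ?a - ?b\<^sup>2 / ?c"
      using pos[of "- ?b / ?c"] c by (simp add: field_simps power2_eq_square)
    then show ?thesis using c by (simp add: field_simps)
  qed
  then have "sqrt (?b\<^sup>2) \<le> sqrt (?a * ?c)" by (rule real_sqrt_le_mono)
  then show ?thesis by (simp add: L2_norm_def real_sqrt_mult)
qed

lemma L2_norm_triangle: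
  assumes "u \<in> L2_space \<Omega>" "v \<in> L2_space \<Omega>"
  shows "L2_norm \<Omega> (\<lambda>x. u x + v x) \<le> L2_norm \<Omega> u + L2_norm \<Omega> v"
proof (rule power2_le_imp_le)
  show "(L2_norm \<Omega> (\<lambda>x. u x + v x))\<^sup>2 \<le> (L2_norm \<Omega> u + L2_norm \<Omega> v)\<^sup>2"
    using L2_Cauchy_Schwarz[OF assms] L2_inner_add_self[OF assms]
    by (simp add: power2_sum L2_norm_square)
qed (simp add: L2_norm_nonneg)

lemma L2_norm_eq_0_iff:
  assumes "u \<in> L2_space \<Omega>"
  shows "L2_norm \<Omega> u = 0 \<longleftrightarrow> (AE x in lebesgue_on \<Omega>. u x = 0)"
proof -
  have "L2_inner \<Omega> u u = 0 \<longleftrightarrow> (AE x in lebesgue_on \<Omega>. u x \<bullet> u x = 0)"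
    unfolding L2_inner_def using L2_inner_integrable[OF assms assms]
    by (intro integral_nonneg_eq_0_iff_AE) auto
  then show ?thesis by (simp add: L2_norm_def)
qed

lemma L2_space_bounded:
  fixes u :: "'a::euclidean_space \<Rightarrow> 'b::euclidean_space"
  assumes \<Omega>: "open \<Omega>" "bounded \<Omega>"
    and u: "u \<in> borel_measurable (lebesgue_on \<Omega>)" "AE x in lebesgue_on \<Omega>. norm (u x) \<le> C"
  shows "u \<in> L2_space \<Omega>"
proof -
  have fin: "finite_measure (lebesgue_on \<Omega>)"
    using \<Omega> by (intro finite_measure_lebesgue_on) (simp add: lmeasurable_open)
  have "integrable (lebesgue_on \<Omega>) (\<lambda>x. (norm (u x))\<^sup>2)"
  proof (rule finite_measure.integrable_const_bound[OF fin])
    show "AE x in lebesgue_on \<Omega>. norm ((norm (u x))\<^sup>2) \<le> C\<^sup>2"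
      using u(2) by eventually_elim (simp add: power_mono)
  qed (use u(1) in auto)
  then show ?thesis using u(1) by (simp add: L2_space_def)
qed

lemma Linf_subset_L2:
  assumes "open \<Omega>" "bounded \<Omega>"
  shows "Linf_space \<Omega> \<subseteq> L2_space \<Omega>"
  using L2_space_bounded[OF assms] by (fastforce simp: Linf_space_def)

lemma L2_space_integrable:
  fixes u :: "'a::euclidean_space \<Rightarrow> real"
  assumes \<Omega>: "open \<Omega>" "bounded \<Omega>" and u: "u \<in> L2_space \<Omega>"
  shows "integrable (lebesgue_on \<Omega>) u"
proof -
  have "(\<lambda>x. 1::real) \<in> L2_space \<Omega>"
    by (rule L2_space_bounded[OF \<Omega>, of _ 1]) auto
  from L2_inner_integrable[OF u this] show ?thesis by simp
qed

section \<open>Smooth bump functions\<close>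

text \<open>
  \<open>flat k t = t\<^sup>-\<^sup>k exp (-1/t)\<close> extended by \<open>0\<close> to \<open>t \<le> 0\<close>. The whole family is needed because
  differentiation raises the index.
\<close>

definition flat :: "nat \<Rightarrow> real \<Rightarrow> real" where
  "flat k t = (if t > 0 then exp (- 1 / t) / t ^ k else 0)"

lemma flat_nonneg: "0 \<le> flat k t"
  by (simp add: flat_def)

lemma flat_le_1: "flat 0 t \<le> 1"
  by (simp add: flat_def)

text \<open>The exponential series at \<open>1/t\<close> has the summand \<open>t\<^sup>-\<^sup>(\<^sup>k\<^sup>+\<^sup>2\<^sup>)/(k+2)!\<close>, hence all functions of the
  family vanish to second order at \<open>0\<close>, so their derivatives there are \<open>0\<close>.\<close>

lemma flat_le_square: "flat k t \<le> fact (k + 2) * t\<^sup>2"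
proof (cases "t > 0")
  case True
  obtain s where s: "exp (1 / t) = (\<Sum>m<Suc (k+2). (1 / t) ^ m / fact m) + (exp s / fact (Suc (k+2))) * (1 / t) ^ Suc (k+2)"
    using Maclaurin_exp_le[of "1 / t" "Suc (k + 2)"] by blast
  have "(1 / t) ^ (k + 2) / fact (k + 2) \<le> (\<Sum>m<Suc (k+2). (1 / t) ^ m / fact m)"
    using True by (intro member_le_sum) auto
  also have "\<dots> \<le> exp (1 / t)"
    unfolding s using True by simp
  finally have "1 / (t ^ (k + 2) * fact (k + 2)) \<le> exp (1 / t)"
    by (simp only: power_one_over divide_divide_eq_left)
  then have "1 \<le> exp (1 / t) * (t ^ (k + 2) * fact (k + 2))"
    using True by (subst (asm) pos_divide_le_eq) auto
  then have "exp (- (1 / t)) \<le> t ^ (k + 2) * fact (k + 2)"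
    unfolding exp_minus by (simp only: inverse_eq_divide divide_le_eq exp_gt_zero if_True mult.commute)
  then have "exp (- (1 / t)) / t ^ k \<le> t ^ (k + 2) * fact (k + 2) / t ^ k"
    using True by (intro divide_right_mono) auto
  also have "\<dots> = fact (k + 2) * t\<^sup>2"
    using True unfolding power_add by (simp del: fact_Suc)
  finally show ?thesis using True by (simp add: flat_def)
qed (simp add: flat_def)

lemma flat_has_real_derivative:
  "(flat k has_real_derivative (flat (k + 2) t - real k * flat (k + 1) t)) (at t)"
proof (cases t "0::real" rule: linorder_cases)
  case less
  show ?thesis
  proof (rule has_field_derivative_transform_within_open)
    show "((\<lambda>_. 0) has_real_derivative (flat (k + 2) t - real k * flat (k + 1) t)) (at t)"
      using less by (auto simp: flat_def)
  qed (use less in \<open>auto simp: flat_def intro: open_lessThan\<close>)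
next
  case greater
  have e: "((\<lambda>t. exp (- inverse t)) has_real_derivative exp (- inverse t) * inverse t ^ 2) (at t)"
    and i: "(inverse has_real_derivative - (inverse t ^ 2)) (at t)"
    using greater by (auto intro!: derivative_eq_intros simp: power2_eq_square)
  have pos: "flat m s = exp (- inverse s) * inverse s ^ m" if "s > 0" for m s
    using that by (simp add: flat_def divide_inverse power_inverse)
  have alg: "E * y ^ 2 * y ^ Suc j + (1 + real j) * (- (y ^ 2) * y ^ j) * E
      = E * y ^ (Suc j + 2) - real (Suc j) * (E * y ^ (Suc j + 1))" for E y :: real and j
    by (simp add: power2_eq_square algebra_simps)
  have "((\<lambda>t. exp (- inverse t) * inverse t ^ k) has_real_derivative
          (flat (k + 2) t - real k * flat (k + 1) t)) (at t)"
  proof (cases k)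
    case 0
    then show ?thesis using e unfolding pos[OF greater] 0
      by (simp only: add_0 of_nat_0 mult_zero_left diff_0_right power_0 mult_1_right)
  next
    case (Suc j)
    show ?thesis
      unfolding Suc pos[OF greater]
      by (rule DERIV_cong[OF DERIV_mult[OF e DERIV_power_Suc[OF i, of j]] alg])
  qed
  then show ?thesis
    by (rule has_field_derivative_transform_within_open[of _ _ _ "{0<..}"])
      (use greater pos in auto)
next
  case equal
  have "((\<lambda>h. (flat k (0 + h) - flat k 0) / h) \<longlongrightarrow> 0) (at 0)"
  proof (rule Lim_null_comparison)
    show "\<forall>\<^sub>F h in at 0. norm ((flat k (0 + h) - flat k 0) / h) \<le> fact (k + 2) * \<bar>h\<bar>"
    proof (intro eventually_at_filter[THEN iffD2] always_eventually allI impI)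
      fix h :: real assume "h \<noteq> 0"
      have "flat k h \<le> fact (k + 2) * \<bar>h\<bar> * \<bar>h\<bar>"
        using flat_le_square[of k h] by (simp only: mult.assoc abs_mult_self_eq power2_eq_square)
      then have "flat k h / \<bar>h\<bar> \<le> fact (k + 2) * \<bar>h\<bar>"
        using \<open>h \<noteq> 0\<close> by (subst pos_divide_le_eq) auto
      then show "norm ((flat k (0 + h) - flat k 0) / h) \<le> fact (k + 2) * \<bar>h\<bar>"
        using flat_nonneg[of k h] flat_def[of k 0] by (simp add: abs_divide del: fact_Suc add_2_eq_Suc')
    qed
    show "((\<lambda>h. fact (k + 2) * \<bar>h\<bar>) \<longlongrightarrow> (0::real)) (at 0)"
      by (auto intro!: tendsto_eq_intros)
  qed
  then show ?thesis using equal by (simp add: DERIV_def flat_def[of _ 0])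
qed

text \<open>A class of functions that contains the bump functions and is closed under partial
  differentiation; membership therefore yields smoothness.\<close>

inductive bump_class :: "('a::euclidean_space \<Rightarrow> real) \<Rightarrow> bool" where
  bump_const: "bump_class (\<lambda>x. c)"
| bump_flat: "bump_class (\<lambda>x. flat k (x \<bullet> v + d))"
| bump_add: "bump_class f \<Longrightarrow> bump_class g \<Longrightarrow> bump_class (\<lambda>x. f x + g x)"
| bump_mult: "bump_class f \<Longrightarrow> bump_class g \<Longrightarrow> bump_class (\<lambda>x. f x * g x)"

lemma bump_prod:
  "finite I \<Longrightarrow> (\<And>i. i \<in> I \<Longrightarrow> bump_class (f i)) \<Longrightarrow> bump_class (\<lambda>x. \<Prod>i\<in>I. f i x)"
  by (induction I rule: finite_induct) (auto intro: bump_const bump_mult)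

lemma bump_class_has_derivative:
  "bump_class f \<Longrightarrow>
     \<exists>f'. (\<forall>x. (f has_derivative f' x) (at x)) \<and> (\<forall>i. bump_class (\<lambda>x. f' x i))"
proof (induction rule: bump_class.induct)
  case (bump_const c)
  show ?case by (rule exI[of _ "\<lambda>_ _. 0"]) (auto intro: bump_class.intros)
next
  case (bump_flat k v d)
  let ?f' = "\<lambda>x i. (flat (k + 2) (x \<bullet> v + d) + (- real k) * flat (k + 1) (x \<bullet> v + d)) * (i \<bullet> v)"
  have der: "((\<lambda>x. flat k (x \<bullet> v + d)) has_derivative ?f' x) (at x)" for x
  proof -
    have "((\<lambda>x. x \<bullet> v + d) has_derivative (\<lambda>i. i \<bullet> v)) (at x)"
      by (auto intro!: derivative_eq_intros)
    from has_derivative_compose[OF this flat_has_real_derivative[unfolded has_field_derivative_def]]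
    show ?thesis by simp
  qed
  show ?case
  proof (intro exI[of _ ?f'] conjI allI der)
    show "bump_class (\<lambda>x. ?f' x i)" for i by (intro bump_class.intros)
  qed
next
  case (bump_add f g)
  then obtain f' g' where *: "\<forall>x. (f has_derivative f' x) (at x)" "\<forall>i. bump_class (\<lambda>x. f' x i)"
    "\<forall>x. (g has_derivative g' x) (at x)" "\<forall>i. bump_class (\<lambda>x. g' x i)" by blast
  then show ?case
    by (intro exI[of _ "\<lambda>x i. f' x i + g' x i"])
      (auto intro!: bump_class.intros has_derivative_add)
next
  case (bump_mult f g)
  then obtain f' g' where *: "\<forall>x. (f has_derivative f' x) (at x)" "\<forall>i. bump_class (\<lambda>x. f' x i)"
    "\<forall>x. (g has_derivative g' x) (at x)" "\<forall>i. bump_class (\<lambda>x. g' x i)" by blast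
  with bump_mult.hyps show ?case
    by (intro exI[of _ "\<lambda>x i. f x * g' x i + f' x i * g x"])
      (auto intro!: bump_class.intros has_derivative_mult)
qed

lemma partial_deriv_eqI: "(f has_derivative f') (at x) \<Longrightarrow> partial_deriv i f x = f' i"
  unfolding partial_deriv_def using frechet_derivative_at by metis

lemma bump_class_partial_deriv:
  assumes "bump_class f" shows "bump_class (partial_deriv i f)"
proof -
  obtain f' where f': "\<forall>x. (f has_derivative f' x) (at x)" "\<forall>i. bump_class (\<lambda>x. f' x i)"
    using bump_class_has_derivative[OF assms] by blast
  then have "partial_deriv i f = (\<lambda>x. f' x i)"
    by (auto intro!: partial_deriv_eqI)
  then show ?thesis using f' by simp
qed

lemma bump_class_smooth: "bump_class f \<Longrightarrow> smooth_fun f"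
proof -
  assume f: "bump_class f"
  have "bump_class (foldr partial_deriv is f)" for "is"
    by (induction "is") (auto intro: f bump_class_partial_deriv)
  then show ?thesis
    unfolding smooth_fun_def differentiable_on_def differentiable_def
    using bump_class_has_derivative by (metis has_derivative_at_withinI)
qed

text \<open>The factors are positive exactly on the open box, and the parameter sharpens their slope.\<close>

definition box_bump :: "'a::euclidean_space \<Rightarrow> 'a \<Rightarrow> nat \<Rightarrow> 'a \<Rightarrow> real" where
  "box_bump a b n x = (\<Prod>i\<in>Basis. flat 0 (real (Suc n) * (x \<bullet> i - a \<bullet> i)) * flat 0 (real (Suc n) * (b \<bullet> i - x \<bullet> i)))"

lemma box_bump_bounds: "0 \<le> box_bump a b n x" "box_bump a b n x \<le> 1"
  unfolding box_bump_def
  by (auto intro!: prod_nonneg prod_le_1 mult_le_one simp: flat_nonneg flat_le_1)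

lemma box_bump_nonzero_iff: "box_bump a b n x \<noteq> 0 \<longleftrightarrow> x \<in> box a b"
proof -
  have "flat 0 (real (Suc n) * t) \<noteq> 0 \<longleftrightarrow> t > 0" for t
    by (auto simp: flat_def zero_less_mult_iff simp del: of_nat_Suc)
  then show ?thesis
    by (auto simp: box_bump_def mem_box)
qed

text \<open>Rescaling \<open>flat 0\<close> by \<open>n\<close> lets it increase to the indicator of the positive half-line.\<close>

lemma box_bump_tendsto_indicator: "(\<lambda>n. box_bump a b n x) \<longlonglongrightarrow> indicator (box a b) x"
proof (cases "x \<in> box a b")
  case True
  have lim: "(\<lambda>n. flat 0 (real (Suc n) * t)) \<longlonglongrightarrow> 1" if "t > 0" for t
  proof -
    have "(\<lambda>n. exp (- (1 / t) * inverse (real (Suc n)))) \<longlonglongrightarrow> exp (- (1 / t) * 0)"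
      by (intro tendsto_intros LIMSEQ_inverse_real_of_nat)
    moreover have "flat 0 (real (Suc n) * t) = exp (- (1 / t) * inverse (real (Suc n)))" for n
      using that by (simp add: flat_def zero_less_mult_iff divide_inverse mult.commute del: of_nat_Suc)
    ultimately show ?thesis by simp
  qed
  have "(\<lambda>n. box_bump a b n x) \<longlonglongrightarrow> (\<Prod>i\<in>(Basis::'a set). 1 * 1)"
    unfolding box_bump_def using True
    by (intro tendsto_prod tendsto_mult lim) (auto simp: mem_box)
  then show ?thesis using True by simp
next
  case False
  then show ?thesis using box_bump_nonzero_iff[of a b _ x] by simp
qed

lemma box_bump_test_funs:
  assumes "cbox a b \<subseteq> \<Omega>"
  shows "box_bump a b n \<in> test_funs \<Omega>"
proof -
  have "bump_class (\<lambda>x. \<Prod>i\<in>Basis. flat 0 (x \<bullet> (real (Suc n) *\<^sub>R i) + (- real (Suc n) * (a \<bullet> i)))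
          * flat 0 (x \<bullet> (- real (Suc n) *\<^sub>R i) + real (Suc n) * (b \<bullet> i)))"
    by (intro bump_prod bump_class.intros) auto
  also have "(\<lambda>x. \<Prod>i\<in>Basis. flat 0 (x \<bullet> (real (Suc n) *\<^sub>R i) + (- real (Suc n) * (a \<bullet> i)))
          * flat 0 (x \<bullet> (- real (Suc n) *\<^sub>R i) + real (Suc n) * (b \<bullet> i))) = box_bump a b n"
    unfolding box_bump_def
    by (rule ext, rule prod.cong) (auto simp: algebra_simps simp del: of_nat_Suc)
  finally have "smooth_fun (box_bump a b n)" by (rule bump_class_smooth)
  moreover have "{x. box_bump a b n x \<noteq> 0} = box a b"
    by (simp add: box_bump_nonzero_iff)
  moreover have "closure (box a b) \<subseteq> cbox a b"
    by (rule closure_minimal) (auto simp: box_subset_cbox)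
  ultimately show ?thesis
    using assms unfolding test_funs_def
    by (auto intro: bounded_subset simp: compact_eq_bounded_closed)
qed

section \<open>Integration by parts against test functions\<close>

lemma integral_lebesgue_on_eq_lborel:
  fixes f :: "'a::euclidean_space \<Rightarrow> real"
  assumes "open \<Omega>" "f \<in> borel_measurable borel" "\<And>x. x \<notin> \<Omega> \<Longrightarrow> f x = 0"
  shows "(LINT x|lebesgue_on \<Omega>. f x) = (LINT x|lborel. f x)"
proof -
  have "(LINT x|lebesgue_on \<Omega>. f x) = (LINT x|lebesgue. indicator \<Omega> x *\<^sub>R f x)"
    using assms(1) by (intro integral_restrict_space) auto
  also have "(\<lambda>x. indicator \<Omega> x *\<^sub>R f x) = f"
    using assms(3) by (auto simp: fun_eq_iff indicator_def)
  also have "(LINT x|lebesgue. f x) = (LINT x|lborel. f x)"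
    using assms(2) by (intro integral_completion) simp
  finally show ?thesis .
qed

lemma continuous_compact_support_integrable:
  fixes f :: "'a::euclidean_space \<Rightarrow> real"
  assumes "continuous_on UNIV f" "compact K" "\<And>x. x \<notin> K \<Longrightarrow> f x = 0"
  shows "integrable lborel f"
proof -
  have "integrable lborel (\<lambda>x. indicator K x *\<^sub>R f x)"
    using assms by (intro borel_integrable_compact) (auto intro: continuous_on_subset)
  also have "(\<lambda>x. indicator K x *\<^sub>R f x) = f"
    using assms(3) by (auto simp: fun_eq_iff indicator_def)
  finally show ?thesis .
qed

lemma continuous_compact_support_bounded:
  fixes f :: "'a::euclidean_space \<Rightarrow> real"
  assumes "continuous_on UNIV f" "compact K" "\<And>x. x \<notin> K \<Longrightarrow> f x = 0"
  obtains M where "M \<ge> 0" "\<And>x. \<bar>f x\<bar> \<le> M"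
proof -
  have "bounded (f ` K)"
    using assms by (intro compact_imp_bounded compact_continuous_image) (auto intro: continuous_on_subset)
  then obtain M where M: "\<forall>x\<in>K. \<bar>f x\<bar> \<le> M" by (auto simp: bounded_iff)
  have "\<bar>f x\<bar> \<le> max M 0" for x
    using M assms(3)[of x] by (cases "x \<in> K") auto
  then show ?thesis using that[of "max M 0"] by auto
qed

text \<open>By translation invariance the integral of the difference quotient of \<open>h\<close> vanishes; by the mean
  value theorem the quotients are values of the directional derivative near \<open>x\<close>, so they are dominated
  and converge to it.\<close>

lemma integral_directional_derivative_eq_0:
  fixes h :: "'a::euclidean_space \<Rightarrow> real"
  assumes der: "\<And>x. (h has_derivative h' x) (at x)"
    and cont: "continuous_on UNIV (\<lambda>x. h' x i)"
    and K: "compact K" "\<And>x. x \<notin> K \<Longrightarrow> h x = 0"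
  shows "(LINT x|lborel. h' x i) = 0"
proof -
  let ?t = "\<lambda>n. inverse (real (Suc n))"
  define q where "q n x = (h (?t n *\<^sub>R i + x) - h x) * real (Suc n)" for n x
  have h'0: "h' x i = 0" if "x \<notin> K" for x
  proof -
    have "(h has_derivative (\<lambda>_. 0)) (at x)"
      by (rule has_derivative_transform_within_open[of "\<lambda>_. 0" _ _ _ "- K"])
        (use K that in \<open>auto intro: compact_imp_closed\<close>)
    then show ?thesis using has_derivative_unique[OF der] by metis
  qed
  obtain M where M: "M \<ge> 0" "\<And>x. \<bar>h' x i\<bar> \<le> M"
    using continuous_compact_support_bounded[OF cont K(1) h'0] by metis
  have conth: "continuous_on UNIV h"
    using der by (intro continuous_at_imp_continuous_on ballI has_derivative_continuous)
  have inth: "integrable lborel h"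
    by (rule continuous_compact_support_integrable[OF conth K])
  have mv: "\<exists>z. 0 < z \<and> z < ?t n \<and> q n x = h' (z *\<^sub>R i + x) i" for n x
  proof -
    have "((\<lambda>s. h (s *\<^sub>R i + x)) has_real_derivative h' (s *\<^sub>R i + x) i) (at s)" for s
    proof -
      have "((\<lambda>s. s *\<^sub>R i + x) has_derivative (\<lambda>r. r *\<^sub>R i)) (at s)"
        by (auto intro!: derivative_eq_intros)
      then have "((\<lambda>s. h (s *\<^sub>R i + x)) has_derivative (\<lambda>r. h' (s *\<^sub>R i + x) (r *\<^sub>R i))) (at s)"
        by (rule has_derivative_compose) (rule der)
      moreover have "(\<lambda>r. h' (s *\<^sub>R i + x) (r *\<^sub>R i)) = (*) (h' (s *\<^sub>R i + x) i)"
        by (auto simp: fun_eq_iff linear_cmul[OF has_derivative_linear[OF der[of "s *\<^sub>R i + x"]]])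
      ultimately show ?thesis by (simp only: has_field_derivative_def)
    qed
    then obtain z where z: "0 < z" "z < ?t n"
      "h (?t n *\<^sub>R i + x) - h (0 *\<^sub>R i + x) = (?t n - 0) * h' (z *\<^sub>R i + x) i"
      using MVT2[of 0 "?t n" "\<lambda>s. h (s *\<^sub>R i + x)" "\<lambda>s. h' (s *\<^sub>R i + x) i"]
      by (auto simp del: of_nat_Suc)
    have q: "q n x = ?t n * h' (z *\<^sub>R i + x) i * real (Suc n)"
      unfolding q_def using z(3) by (simp only: scaleR_zero_left add_0 diff_0_right)
    have nz: "real (Suc n) \<noteq> 0" by simp
    have "?t n * h' (z *\<^sub>R i + x) i * real (Suc n) = h' (z *\<^sub>R i + x) i"
      by (simp only: mult.commute[of "?t n"] mult.assoc right_inverse[OF nz] left_inverse[OF nz] mult_1_right)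
    with z(1,2) show ?thesis using q by metis
  qed
  obtain R where R: "K \<subseteq> cball 0 R"
    using compact_imp_bounded[OF K(1)] unfolding bounded_iff subset_iff mem_cball_0 by blast
  have "(\<lambda>n. LINT x|lborel. q n x) \<longlonglongrightarrow> (LINT x|lborel. h' x i)"
  proof (rule integral_dominated_convergence[where w = "\<lambda>x. M * indicator (cball 0 (R + norm i)) x"])
    show "(\<lambda>x. h' x i) \<in> borel_measurable lborel"
      using borel_measurable_continuous_onI[OF cont] by simp
    have [measurable]: "h \<in> borel_measurable borel"
      using conth by (simp add: borel_measurable_continuous_onI)
    have "(\<lambda>x. (h (c + x) - h x) * d) \<in> borel_measurable borel" for c d
      by measurable
    moreover have "q n = (\<lambda>x. (h (?t n *\<^sub>R i + x) - h x) * real (Suc n))" for n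
      by (rule ext) (rule q_def)
    ultimately show "q n \<in> borel_measurable lborel" for n
      by simp
    show "integrable lborel (\<lambda>x. M * indicator (cball 0 (R + norm i)) x :: real)"
      by (intro integrable_mult_right integrable_real_indicator emeasure_bounded_finite bounded_cball) simp
    have q0: "q n x = 0" if "x \<notin> cball 0 (R + norm i)" for n x
    proof -
      have "?t n \<le> 1" unfolding inverse_le_1_iff by simp
      then have "?t n * norm i \<le> 1 * norm i" by (rule mult_right_mono) simp
      moreover have "norm (?t n *\<^sub>R i) = ?t n * norm i"
        unfolding norm_scaleR by simp
      moreover have "norm x - norm (?t n *\<^sub>R i) \<le> norm (?t n *\<^sub>R i + x)"
        using norm_diff_ineq[of x "?t n *\<^sub>R i"] by (simp only: add.commute)
      moreover have "norm i \<ge> 0" "norm x > R + norm i" using that by auto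
      ultimately have "norm (?t n *\<^sub>R i + x) > R" "norm x > R" by linarith+
      then have "?t n *\<^sub>R i + x \<notin> K" "x \<notin> K"
        using R by (force simp del: of_nat_Suc)+
      then show ?thesis using K(2) by (simp add: q_def)
    qed
    have qM: "\<bar>q n x\<bar> \<le> M" for n x
      using mv[of n x] M(2) by metis
    have "norm (q n x) \<le> M * indicator (cball 0 (R + norm i)) x" for n x
    proof (cases "x \<in> cball 0 (R + norm i)")
      case True
      then show ?thesis using qM[of n x] by simp
    next
      case False
      then show ?thesis using q0[of x n] by simp
    qed
    then show "AE x in lborel. norm (q n x) \<le> M * indicator (cball 0 (R + norm i)) x" for n
      by (intro AE_I2) blast
    have "(\<lambda>n. q n x) \<longlonglongrightarrow> h' x i" for x
    proof -
      obtain z where z: "\<And>n. 0 < z n \<and> z n < ?t n \<and> q n x = h' (z n *\<^sub>R i + x) i"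
        using mv[of _ x] by metis
      have "z \<longlonglongrightarrow> 0"
        by (rule tendsto_sandwich[OF _ _ tendsto_const LIMSEQ_inverse_real_of_nat])
          (use z in \<open>auto intro!: always_eventually less_imp_le\<close>)
      then have "(\<lambda>n. z n *\<^sub>R i + x) \<longlonglongrightarrow> 0 *\<^sub>R i + x"
        by (intro tendsto_intros)
      moreover have "isCont (\<lambda>x. h' x i) x"
        using cont by (simp add: continuous_on_eq_continuous_at)
      ultimately have "(\<lambda>n. h' (z n *\<^sub>R i + x) i) \<longlonglongrightarrow> h' x i"
        using isCont_tendsto_compose by fastforce
      then show ?thesis using z by simp
    qed
    then show "AE x in lborel. (\<lambda>n. q n x) \<longlonglongrightarrow> h' x i" by simp
  qed
  moreover have "(LINT x|lborel. q n x) = 0" for n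
  proof -
    have [measurable]: "h \<in> borel_measurable borel"
      using conth by (simp add: borel_measurable_continuous_onI)
    have "integrable (distr lborel borel ((+) (?t n *\<^sub>R i))) h"
      using inth by (simp only: lborel_distr_plus)
    then have i1: "integrable lborel (\<lambda>x. h (?t n *\<^sub>R i + x))"
      by (subst (asm) integrable_distr_eq) auto
    have "(LINT x|lborel. h x) = (LINT x|distr lborel borel ((+) (?t n *\<^sub>R i)). h x)"
      by (simp only: lborel_distr_plus)
    also have "\<dots> = (LINT x|lborel. h (?t n *\<^sub>R i + x))"
      by (subst integral_distr) auto
    finally show ?thesis
      unfolding q_def using i1 inth by simp
  qed
  ultimately show ?thesis
    by (simp add: LIMSEQ_const_iff)
qed

definition classical_grad :: "('a::euclidean_space \<Rightarrow> real) \<Rightarrow> 'a \<Rightarrow> 'a" where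
  "classical_grad \<eta> x = (\<Sum>i\<in>Basis. partial_deriv i \<eta> x *\<^sub>R i)"

lemma classical_grad_inner_Basis: "i \<in> Basis \<Longrightarrow> classical_grad \<eta> x \<bullet> i = partial_deriv i \<eta> x"
  unfolding classical_grad_def by (rule inner_sum_left_Basis)

lemma smooth_fun_has_derivative:
  assumes "smooth_fun \<eta>"
  shows "(\<eta> has_derivative frechet_derivative \<eta> (at x)) (at x)"
proof -
  have "\<eta> differentiable_on UNIV"
    using assms[unfolded smooth_fun_def, rule_format, of "[]"] by simp
  then show ?thesis
    by (simp add: differentiable_on_def frechet_derivative_works)
qed

lemma smooth_fun_continuous: "smooth_fun \<eta> \<Longrightarrow> continuous_on UNIV \<eta>"
  by (intro continuous_at_imp_continuous_on ballI has_derivative_continuous[OF smooth_fun_has_derivative])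

lemma smooth_fun_partial_deriv_continuous:
  assumes "smooth_fun \<eta>" "i \<in> Basis"
  shows "continuous_on UNIV (partial_deriv i \<eta>)"
proof -
  have "partial_deriv i \<eta> differentiable_on UNIV"
    using assms(1)[unfolded smooth_fun_def, rule_format, of "[i]"] assms(2) by simp
  then show ?thesis by (rule differentiable_imp_continuous_on)
qed

lemma test_fun_outside: "x \<notin> closure {x. \<eta> x \<noteq> 0} \<Longrightarrow> \<eta> x = 0"
  using closure_subset[of "{x. \<eta> x \<noteq> 0}"] by (auto simp: subset_iff)

lemma test_fun_partial_deriv_outside:
  fixes \<eta> :: "'a::euclidean_space \<Rightarrow> real"
  assumes "x \<notin> closure {x. \<eta> x \<noteq> 0}"
  shows "partial_deriv i \<eta> x = 0"
proof -
  have "(\<eta> has_derivative (\<lambda>_. 0)) (at x)"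
  proof (rule has_derivative_transform_within_open[of "\<lambda>_. 0" _ _ _ "- closure {x. \<eta> x \<noteq> 0}"])
    show "0 = \<eta> y" if "y \<in> - closure {x. \<eta> x \<noteq> 0}" for y
      using test_fun_outside[of y \<eta>] that by simp
  qed (use assms in \<open>simp_all add: open_Compl\<close>)
  from partial_deriv_eqI[OF this] show ?thesis .
qed

text \<open>The partial derivative of \<open>f \<zeta>\<close>, a function with compact support, integrates to \<open>0\<close>. The first
  factor is a general \<open>f\<close> so that \<open>f x = (x \<bullet> e) * \<eta> x\<close> may be taken in the proof of the Poincare inequality.\<close>

lemma test_fun_ibp:
  fixes f :: "'a::euclidean_space \<Rightarrow> real"
  assumes \<Omega>: "open \<Omega>" and \<zeta>: "\<zeta> \<in> test_funs \<Omega>" and i: "i \<in> Basis"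
    and der: "\<And>x. (f has_derivative f' x) (at x)" and cont: "continuous_on UNIV (\<lambda>x. f' x i)"
  shows "(LINT x|lebesgue_on \<Omega>. f x * partial_deriv i \<zeta> x) = - (LINT x|lebesgue_on \<Omega>. f' x i * \<zeta> x)"
proof -
  let ?K = "closure {x. \<zeta> x \<noteq> 0}"
  have s: "smooth_fun \<zeta>" and K: "compact ?K" "?K \<subseteq> \<Omega>"
    using \<zeta> by (auto simp: test_funs_def)
  have cf: "continuous_on UNIV f"
    using der by (intro continuous_at_imp_continuous_on ballI has_derivative_continuous)
  note c = cf cont smooth_fun_continuous[OF s] smooth_fun_partial_deriv_continuous[OF s i]
  let ?A = "\<lambda>x. f x * partial_deriv i \<zeta> x" and ?B = "\<lambda>x. f' x i * \<zeta> x"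
  have cA: "continuous_on UNIV ?A" and cB: "continuous_on UNIV ?B"
    using c by (auto intro!: continuous_intros)
  have oA: "?A x = 0" and oB: "?B x = 0" if "x \<notin> ?K" for x
    using test_fun_outside[OF that] test_fun_partial_deriv_outside[OF that] by simp_all
  have "(LINT x|lborel. f x * frechet_derivative \<zeta> (at x) i + f' x i * \<zeta> x) = 0"
  proof (rule integral_directional_derivative_eq_0[where h = "\<lambda>x. f x * \<zeta> x" and K = ?K
        and h' = "\<lambda>x v. f x * frechet_derivative \<zeta> (at x) v + f' x v * \<zeta> x"])
    show "((\<lambda>x. f x * \<zeta> x) has_derivative (\<lambda>v. f x * frechet_derivative \<zeta> (at x) v + f' x v * \<zeta> x)) (at x)" for x
      by (rule has_derivative_mult[OF der smooth_fun_has_derivative[OF s]])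
    show "continuous_on UNIV (\<lambda>x. f x * frechet_derivative \<zeta> (at x) i + f' x i * \<zeta> x)"
      using continuous_on_add[OF cA cB] by (simp only: partial_deriv_def)
    show "f x * \<zeta> x = 0" if "x \<notin> ?K" for x
      using test_fun_outside[OF that] by simp
  qed (rule K(1))
  then have "(LINT x|lborel. ?A x) + (LINT x|lborel. ?B x) = 0"
    using continuous_compact_support_integrable[OF cA K(1) oA]
      continuous_compact_support_integrable[OF cB K(1) oB]
    unfolding partial_deriv_def by simp
  moreover have "(LINT x|lebesgue_on \<Omega>. ?A x) = (LINT x|lborel. ?A x)"
  proof (rule integral_lebesgue_on_eq_lborel[OF \<Omega> borel_measurable_continuous_onI[OF cA]])
    show "?A x = 0" if "x \<notin> \<Omega>" for x
      using that K(2) by (intro oA) (rule contra_subsetD)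
  qed
  moreover have "(LINT x|lebesgue_on \<Omega>. ?B x) = (LINT x|lborel. ?B x)"
  proof (rule integral_lebesgue_on_eq_lborel[OF \<Omega> borel_measurable_continuous_onI[OF cB]])
    show "?B x = 0" if "x \<notin> \<Omega>" for x
      using that K(2) by (intro oB) (rule contra_subsetD)
  qed
  ultimately show ?thesis by simp
qed

section \<open>Test functions form a vector space\<close>

lemma foldr_partial_deriv_add:
  assumes f: "smooth_fun f" and g: "smooth_fun g" and "is \<in> lists Basis"
  shows "foldr partial_deriv is (\<lambda>x. f x + g x)
           = (\<lambda>x. foldr partial_deriv is f x + foldr partial_deriv is g x)"
  using assms(3)
proof (induction "is")
  case Nil
  then show ?case by simp
next
  case (Cons i "is")
  then have "is": "is \<in> lists Basis" by simp
  have "partial_deriv i (\<lambda>x. foldr partial_deriv is f x + foldr partial_deriv is g x) x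
      = partial_deriv i (foldr partial_deriv is f) x + partial_deriv i (foldr partial_deriv is g) x" for x
  proof -
    have "foldr partial_deriv is f differentiable (at x)" "foldr partial_deriv is g differentiable (at x)"
      using f g "is" by (simp_all add: smooth_fun_def differentiable_on_def)
    then have "((\<lambda>x. foldr partial_deriv is f x + foldr partial_deriv is g x) has_derivative
        (\<lambda>v. frechet_derivative (foldr partial_deriv is f) (at x) v
           + frechet_derivative (foldr partial_deriv is g) (at x) v)) (at x)"
      by (intro has_derivative_add) (simp_all add: frechet_derivative_works)
    from partial_deriv_eqI[OF this] show ?thesis by (simp add: partial_deriv_def)
  qed
  then show ?case by (intro ext) (simp add: Cons.IH)
qed

lemma foldr_partial_deriv_mult:
  assumes f: "smooth_fun f" and "is \<in> lists Basis"
  shows "foldr partial_deriv is (\<lambda>x. c * f x) = (\<lambda>x. c * foldr partial_deriv is f x)"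
  using assms(2)
proof (induction "is")
  case Nil
  then show ?case by simp
next
  case (Cons i "is")
  then have "is": "is \<in> lists Basis" by simp
  have "partial_deriv i (\<lambda>x. c * foldr partial_deriv is f x) x
      = c * partial_deriv i (foldr partial_deriv is f) x" for x
  proof -
    have "foldr partial_deriv is f differentiable (at x)"
      using f "is" by (simp add: smooth_fun_def differentiable_on_def)
    then have "((\<lambda>x. c * foldr partial_deriv is f x) has_derivative
        (\<lambda>v. c * frechet_derivative (foldr partial_deriv is f) (at x) v)) (at x)"
      by (intro has_derivative_mult_right) (simp add: frechet_derivative_works)
    from partial_deriv_eqI[OF this] show ?thesis by (simp add: partial_deriv_def)
  qed
  then show ?case by (intro ext) (simp add: Cons.IH)
qed

lemma smooth_fun_add: "smooth_fun f \<Longrightarrow> smooth_fun g \<Longrightarrow> smooth_fun (\<lambda>x. f x + g x)"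
  unfolding smooth_fun_def[of "\<lambda>x. f x + g x"]
  by (intro ballI) (simp add: foldr_partial_deriv_add, simp add: smooth_fun_def differentiable_on_add)

lemma smooth_fun_mult: "smooth_fun f \<Longrightarrow> smooth_fun (\<lambda>x. c * f x)"
  unfolding smooth_fun_def[of "\<lambda>x. c * f x"]
  by (intro ballI) (simp add: foldr_partial_deriv_mult,
      simp add: smooth_fun_def differentiable_on_mult differentiable_on_const)

lemma test_funs_I:
  assumes "smooth_fun f" "compact K" "K \<subseteq> \<Omega>" "\<And>x. x \<notin> K \<Longrightarrow> f x = 0"
  shows "f \<in> test_funs \<Omega>"
proof -
  have "closure {x. f x \<noteq> 0} \<subseteq> K"
    using assms(2,4) by (intro closure_minimal compact_imp_closed) auto
  moreover from this have "compact (closure {x. f x \<noteq> 0})"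
    using bounded_subset[OF compact_imp_bounded[OF assms(2)]] by (simp add: compact_eq_bounded_closed)
  ultimately have "compact (closure {x. f x \<noteq> 0})" "closure {x. f x \<noteq> 0} \<subseteq> \<Omega>"
    using assms(3) by simp_all
  then show ?thesis using assms(1) by (simp add: test_funs_def)
qed

lemma test_funs_add:
  assumes "f \<in> test_funs \<Omega>" "g \<in> test_funs \<Omega>"
  shows "(\<lambda>x. f x + g x) \<in> test_funs \<Omega>"
proof (rule test_funs_I)
  show "smooth_fun (\<lambda>x. f x + g x)" "compact (closure {x. f x \<noteq> 0} \<union> closure {x. g x \<noteq> 0})"
    "closure {x. f x \<noteq> 0} \<union> closure {x. g x \<noteq> 0} \<subseteq> \<Omega>"
    using assms by (simp_all add: test_funs_def smooth_fun_add compact_Un)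
  show "f x + g x = 0" if "x \<notin> closure {x. f x \<noteq> 0} \<union> closure {x. g x \<noteq> 0}" for x
    using that test_fun_outside[of x f] test_fun_outside[of x g] by simp
qed

lemma test_funs_mult:
  assumes "f \<in> test_funs \<Omega>"
  shows "(\<lambda>x. c * f x) \<in> test_funs \<Omega>"
proof (rule test_funs_I)
  show "smooth_fun (\<lambda>x. c * f x)" "compact (closure {x. f x \<noteq> 0})" "closure {x. f x \<noteq> 0} \<subseteq> \<Omega>"
    using assms by (simp_all add: test_funs_def smooth_fun_mult)
  show "c * f x = 0" if "x \<notin> closure {x. f x \<noteq> 0}" for x
    using that test_fun_outside[of x f] by simp
qed

section \<open>The fundamental lemma of the calculus of variations\<close>

text \<open>Boxes are stable under intersection and generate the Borel sets, so a Dynkin argument extends the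
  hypothesis from boxes to all Borel sets. The whole space is not a box, hence the separate assumption
  on the total integral, which complements need.\<close>

lemma AE_zero_if_box_integrals_zero:
  fixes k :: "'a::euclidean_space \<Rightarrow> real"
  assumes k: "integrable lborel k" and total: "(LINT x|lborel. k x) = 0"
    and box: "\<And>a b. set_lebesgue_integral lborel (box a b) k = 0"
  shows "AE x in lborel. k x = 0"
proof (rule sigma_finite_measure.density_zero[OF sigma_finite_lborel k])
  fix A :: "'a set" assume "A \<in> sets lborel"
  then have A: "A \<in> sigma_sets UNIV (range (\<lambda>(a, b). box a b))"
    by (simp add: borel_eq_box)
  have sets: "A \<in> sigma_sets UNIV (range (\<lambda>(a, b). box a b)) \<Longrightarrow> A \<in> sets lborel" for A :: "'a set"
    by (simp add: borel_eq_box)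
  have int: "set_integrable lborel A k" if "A \<in> sets lborel" for A
    unfolding set_integrable_def using that k by (rule integrable_mult_indicator)
  have st: "Int_stable (range (\<lambda>(a, b). box a b :: 'a set))"
    by (auto simp: Int_stable_def box_Int_box)
  have sub: "range (\<lambda>(a, b). box a b :: 'a set) \<subseteq> Pow UNIV" by simp
  from st sub A show "set_lebesgue_integral lborel A k = 0"
  proof (induction rule: sigma_sets_induct_disjoint)
    case (basic A)
    then show ?case using box by auto
  next
    case empty
    show ?case by (simp add: set_lebesgue_integral_def)
  next
    case (compl A)
    have "set_lebesgue_integral lborel (UNIV - A) k
            = (LINT x|lborel. k x - indicator A x *\<^sub>R k x)"
      unfolding set_lebesgue_integral_def
      by (rule Bochner_Integration.integral_cong) (simp_all add: indicator_def)
    also have "\<dots> = (LINT x|lborel. k x) - set_lebesgue_integral lborel A k"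
      using k int[OF sets[OF compl(1)]] unfolding set_lebesgue_integral_def set_integrable_def
      by (rule Bochner_Integration.integral_diff)
    finally show ?case using total compl(2) by simp
  next
    case (union A)
    have m: "A i \<in> sets lborel" for i
      using union(2) by (intro sets) auto
    have "set_lebesgue_integral lborel (\<Union>i. A i) k = (\<Sum>i. set_lebesgue_integral lborel (A i) k)"
    proof (rule lebesgue_integral_countable_add[OF m])
      show "A i \<inter> A j = {}" if "i \<noteq> j" for i j
        using union(1) that unfolding disjoint_family_on_def by blast
      show "set_integrable lborel (\<Union>i. A i) k"
        using m by (intro int sets.countable_UN) blast
    qed
    then show ?case using union(3) by simp
  qed
qed

lemma integrable_mult_bounded:
  fixes h :: "'a::euclidean_space \<Rightarrow> real"
  assumes h: "integrable (lebesgue_on \<Omega>) h"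
    and e: "e \<in> borel_measurable borel" "\<And>x. \<bar>e x\<bar> \<le> 1"
  shows "integrable (lebesgue_on \<Omega>) (\<lambda>x. h x * e x)"
proof (rule Bochner_Integration.integrable_bound[OF h])
  have [measurable]: "e \<in> borel_measurable (lebesgue_on \<Omega>)"
    using e(1) by (simp add: measurable_restrict_space1 measurable_completion)
  show "(\<lambda>x. h x * e x) \<in> borel_measurable (lebesgue_on \<Omega>)"
    using h by measurable
  show "AE x in lebesgue_on \<Omega>. norm (h x * e x) \<le> norm (h x)"
    using e(2) by (intro AE_I2) (simp add: abs_mult mult_left_le)
qed

text \<open>The bump functions of the box converge boundedly to its indicator.\<close>

lemma box_integral_zero:
  fixes h :: "'a::euclidean_space \<Rightarrow> real"
  assumes h: "integrable (lebesgue_on \<Omega>) h"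
    and z: "\<And>\<eta>. \<eta> \<in> test_funs \<Omega> \<Longrightarrow> (LINT x|lebesgue_on \<Omega>. h x * \<eta> x) = 0"
    and ab: "cbox a b \<subseteq> \<Omega>"
  shows "(LINT x|lebesgue_on \<Omega>. h x * indicator (box a b) x) = 0"
proof -
  have cb: "continuous_on UNIV (box_bump a b n)" for n
    using box_bump_test_funs[OF ab, of n] by (intro smooth_fun_continuous) (simp add: test_funs_def)
  have ab1: "\<bar>box_bump a b n x\<bar> \<le> 1" for n x
    using box_bump_bounds[of a b n x] by simp
  have "(\<lambda>n. LINT x|lebesgue_on \<Omega>. h x * box_bump a b n x)
          \<longlonglongrightarrow> (LINT x|lebesgue_on \<Omega>. h x * indicator (box a b) x)"
  proof (rule integral_dominated_convergence[where w = "\<lambda>x. norm (h x)"])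
    show "(\<lambda>x. h x * indicator (box a b) x) \<in> borel_measurable (lebesgue_on \<Omega>)"
      by (rule borel_measurable_integrable, rule integrable_mult_bounded[OF h])
        (auto simp: indicator_def)
    show "(\<lambda>x. h x * box_bump a b n x) \<in> borel_measurable (lebesgue_on \<Omega>)" for n
      by (rule borel_measurable_integrable, rule integrable_mult_bounded[OF h borel_measurable_continuous_onI[OF cb] ab1])
    show "integrable (lebesgue_on \<Omega>) (\<lambda>x. norm (h x))"
      using h by (rule integrable_norm)
    show "AE x in lebesgue_on \<Omega>. (\<lambda>n. h x * box_bump a b n x) \<longlonglongrightarrow> h x * indicator (box a b) x"
      by (intro AE_I2 tendsto_mult tendsto_const box_bump_tendsto_indicator)
    show "AE x in lebesgue_on \<Omega>. norm (h x * box_bump a b n x) \<le> norm (h x)" for n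
      using ab1 by (intro AE_I2) (simp add: abs_mult mult_left_le)
  qed
  moreover have "(LINT x|lebesgue_on \<Omega>. h x * box_bump a b n x) = 0" for n
    by (rule z[OF box_bump_test_funs[OF ab]])
  ultimately show ?thesis by (simp add: LIMSEQ_const_iff)
qed

text \<open>By dominated convergence the hypothesis passes from test functions to indicators of boxes. This
  needs the closed box inside the domain, so the argument is made on one box at a time, and the domain is
  a countable union of boxes.\<close>

lemma fundamental_lemma_variations:
  fixes h :: "'a::euclidean_space \<Rightarrow> real"
  assumes h: "integrable (lebesgue_on \<Omega>) h" and \<Omega>: "open \<Omega>"
    and z: "\<And>\<eta>. \<eta> \<in> test_funs \<Omega> \<Longrightarrow> (LINT x|lebesgue_on \<Omega>. h x * \<eta> x) = 0"
  shows "AE x in lebesgue_on \<Omega>. h x = 0"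
proof -
  have \<Omega>s: "\<Omega> \<inter> space lebesgue \<in> sets lebesgue" using \<Omega> by simp
  have hi: "integrable lebesgue (\<lambda>x. indicator \<Omega> x *\<^sub>R h x)"
    using h unfolding integrable_restrict_space[OF \<Omega>s] .
  have local: "AE x in lebesgue. x \<in> box a b \<longrightarrow> h x = 0" if ab: "cbox a b \<subseteq> \<Omega>" for a b
  proof -
    define k where "k = (\<lambda>x. indicator (box a b) x *\<^sub>R (indicator \<Omega> x *\<^sub>R h x))"
    (* A Borel representative is needed because boxes generate the Borel sets only. *)
    have ki: "integrable lebesgue k"
      unfolding k_def by (rule integrable_mult_indicator[OF _ hi]) simp
    obtain k' where k': "k' \<in> borel_measurable lborel" "AE x in lborel. k x = k' x"
      using completion_ex_borel_measurable_real[OF borel_measurable_integrable[OF ki]] by blast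
    have ae: "AE x in lebesgue. k x = k' x" using k'(2) by (rule AE_completion)
    have k'l: "k' \<in> borel_measurable lebesgue" using k'(1) by (rule measurable_completion)
    have "integrable lebesgue k'"
      using integrable_cong_AE[OF borel_measurable_integrable[OF ki] k'l ae] ki by simp
    then have k'i: "integrable lborel k'"
      using integrable_completion[OF k'(1)] by simp
    have boxes: "set_lebesgue_integral lborel (box c d) k' = 0" for c d
    proof -
      obtain p q where pq: "box a b \<inter> box c d = box p q" using box_Int_box by blast
      have "(LINT x|lebesgue_on \<Omega>. h x * indicator (box p q) x) = 0"
      proof (cases "box p q = {}")
        case False
        then have "cbox p q = closure (box p q)" by (simp add: closure_box)
        also have "\<dots> \<subseteq> closure (cbox a b)"
          using pq box_subset_cbox[of a b] by (intro closure_mono) blast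
        finally have sub: "cbox p q \<subseteq> \<Omega>" using ab by simp
        show ?thesis by (rule box_integral_zero[OF h _ sub]) (rule z)
      qed simp
      moreover have "(LINT x|lebesgue_on \<Omega>. h x * indicator (box p q) x)
          = (LINT x|lebesgue. indicator \<Omega> x *\<^sub>R (h x * indicator (box p q) x))"
        by (rule integral_restrict_space[OF \<Omega>s])
      moreover have "\<dots> = (LINT x|lebesgue. indicator (box c d) x *\<^sub>R k x)"
        unfolding k_def pq[symmetric]
        by (rule Bochner_Integration.integral_cong) (auto simp: indicator_def)
      moreover have "\<dots> = (LINT x|lebesgue. indicator (box c d) x *\<^sub>R k' x)"
      proof (rule integral_cong_AE)
        show "AE x in lebesgue. indicator (box c d) x *\<^sub>R k x = indicator (box c d) x *\<^sub>R k' x"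
          using ae by eventually_elim simp
        show "(\<lambda>x. indicator (box c d) x *\<^sub>R k x) \<in> borel_measurable lebesgue"
          "(\<lambda>x. indicator (box c d) x *\<^sub>R k' x) \<in> borel_measurable lebesgue"
          using borel_measurable_integrable[OF ki] k'l
          by (intro borel_measurable_scaleR borel_measurable_indicator; simp)+
      qed
      moreover have "\<dots> = set_lebesgue_integral lborel (box c d) k'"
        unfolding set_lebesgue_integral_def
        by (rule integral_completion, intro borel_measurable_scaleR borel_measurable_indicator k'(1)) simp
      ultimately show ?thesis by simp
    qed
    have "(LINT x|lborel. k' x) = set_lebesgue_integral lborel (box a b) k'"
      unfolding set_lebesgue_integral_def
    proof (rule integral_cong_AE)
      show "AE x in lborel. k' x = indicator (box a b) x *\<^sub>R k' x"
        using k'(2) by eventually_elim (auto simp: k_def indicator_def)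
      show "(\<lambda>x. indicator (box a b) x *\<^sub>R k' x) \<in> borel_measurable lborel"
        by (intro borel_measurable_scaleR borel_measurable_indicator k'(1)) simp
    qed (rule k'(1))
    then have "AE x in lborel. k' x = 0"
      using boxes by (intro AE_zero_if_box_integrals_zero[OF k'i]) auto
    then have "AE x in lebesgue. k' x = 0" by (rule AE_completion)
    with ae show ?thesis
      by eventually_elim (use ab box_subset_cbox[of a b] in \<open>auto simp: k_def indicator_def split: if_splits\<close>)
  qed
  obtain D where D: "countable D" "D \<subseteq> Pow \<Omega>" "\<And>X. X \<in> D \<Longrightarrow> \<exists>a b. X = cbox a b" "\<Union>D = \<Omega>"
    using open_countable_Union_open_cbox[OF \<Omega>] by metis
  have "AE x in lebesgue. x \<in> X \<longrightarrow> h x = 0" if XD: "X \<in> D" for X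
  proof -
    obtain a b where X: "X = cbox a b" using D(3)[OF XD] by blast
    (* The covering boxes are closed, so their boundaries are to be discarded. *)
    have "cbox a b - box a b \<in> null_sets lebesgue"
      using negligible_frontier_interval[of a b] by (simp add: negligible_iff_null_sets)
    then have "AE x in lebesgue. x \<notin> cbox a b - box a b" by (rule AE_not_in)
    moreover have "AE x in lebesgue. x \<in> box a b \<longrightarrow> h x = 0"
      using D(2) XD X by (intro local) auto
    ultimately show ?thesis unfolding X by eventually_elim auto
  qed
  then have "AE x in lebesgue. \<forall>X\<in>D. x \<in> X \<longrightarrow> h x = 0"
    by (subst AE_ball_countable[OF D(1)]) blast
  then have "AE x in lebesgue. x \<in> \<Omega> \<longrightarrow> h x = 0"
    by eventually_elim (use D(4) in blast)
  then show ?thesis using AE_restrict_space_iff[OF \<Omega>s] by blast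
qed

section \<open>Weak gradients and the spaces \<open>H\<^sup>1\<close> and \<open>H\<^sup>1\<^sub>0\<close>\<close>

locale bounded_open_set =
  fixes \<Omega> :: "'a::euclidean_space set"
  assumes open_dom: "open \<Omega>" and bounded_dom: "bounded \<Omega>"
begin

lemma continuous_compact_support_L2:
  fixes f :: "'a \<Rightarrow> real"
  assumes "continuous_on UNIV f" "compact K" "\<And>x. x \<notin> K \<Longrightarrow> f x = 0"
  shows "f \<in> L2_space \<Omega>"
proof -
  obtain M where M: "\<And>x. \<bar>f x\<bar> \<le> M"
    using continuous_compact_support_bounded[OF assms] by metis
  have "f \<in> borel_measurable (lebesgue_on \<Omega>)"
    using borel_measurable_continuous_onI[OF assms(1)]
    by (simp add: measurable_restrict_space1 measurable_completion)
  then show ?thesis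
  proof (rule L2_space_bounded[OF open_dom bounded_dom])
    show "AE x in lebesgue_on \<Omega>. norm (f x) \<le> M"
      using M by (intro AE_I2) (simp only: real_norm_def)
  qed
qed

lemma test_fun_L2:
  assumes "\<eta> \<in> test_funs \<Omega>" shows "\<eta> \<in> L2_space \<Omega>"
proof (rule continuous_compact_support_L2)
  show "continuous_on UNIV \<eta>" "compact (closure {x. \<eta> x \<noteq> 0})"
    using assms by (simp_all add: test_funs_def smooth_fun_continuous)
qed (rule test_fun_outside)

lemma test_fun_partial_deriv_L2:
  assumes "\<eta> \<in> test_funs \<Omega>" "i \<in> Basis" shows "partial_deriv i \<eta> \<in> L2_space \<Omega>"
proof (rule continuous_compact_support_L2)
  show "continuous_on UNIV (partial_deriv i \<eta>)" "compact (closure {x. \<eta> x \<noteq> 0})"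
    using assms by (simp_all add: test_funs_def smooth_fun_partial_deriv_continuous)
qed (rule test_fun_partial_deriv_outside)

lemma L2_space_component:
  fixes G :: "'a \<Rightarrow> 'a"
  assumes "G \<in> L2_space \<Omega>" "i \<in> Basis"
  shows "(\<lambda>x. G x \<bullet> i) \<in> L2_space \<Omega>"
proof -
  have m: "(\<lambda>x. G x \<bullet> i) \<in> borel_measurable (lebesgue_on \<Omega>)"
    using assms(1) unfolding L2_space_def by (auto intro!: borel_measurable_inner)
  have "integrable (lebesgue_on \<Omega>) (\<lambda>x. (norm (G x \<bullet> i))\<^sup>2)"
  proof (rule Bochner_Integration.integrable_bound)
    show "integrable (lebesgue_on \<Omega>) (\<lambda>x. (norm (G x))\<^sup>2)"
      using assms(1) by (simp add: L2_space_def)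
    show "(\<lambda>x. (norm (G x \<bullet> i))\<^sup>2) \<in> borel_measurable (lebesgue_on \<Omega>)"
      using m by simp
    have "(norm (G x \<bullet> i))\<^sup>2 \<le> (norm (G x))\<^sup>2" for x
      using Basis_le_norm[OF assms(2), of "G x"] by (intro power_mono) auto
    then show "AE x in lebesgue_on \<Omega>. norm ((norm (G x \<bullet> i))\<^sup>2) \<le> norm ((norm (G x))\<^sup>2)"
      by (intro AE_I2) simp
  qed
  with m show ?thesis by (simp add: L2_space_def)
qed

lemma L2_prod_integrable:
  fixes u v :: "'a \<Rightarrow> real"
  assumes "u \<in> L2_space \<Omega>" "v \<in> L2_space \<Omega>"
  shows "integrable (lebesgue_on \<Omega>) (\<lambda>x. u x * v x)"
  using L2_inner_integrable[OF assms] by simp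

lemma is_weak_grad_add:
  assumes "u \<in> L2_space \<Omega>" "v \<in> L2_space \<Omega>" "G \<in> L2_space \<Omega>" "K \<in> L2_space \<Omega>"
    and "is_weak_grad \<Omega> u G" "is_weak_grad \<Omega> v K"
  shows "is_weak_grad \<Omega> (\<lambda>x. u x + v x) (\<lambda>x. G x + K x)"
  unfolding is_weak_grad_def
proof (intro ballI)
  fix \<eta> and i :: 'a assume e: "\<eta> \<in> test_funs \<Omega>" and i: "i \<in> Basis"
  note d = test_fun_partial_deriv_L2[OF e i] and t = test_fun_L2[OF e]
  have "(LINT x|lebesgue_on \<Omega>. u x * partial_deriv i \<eta> x) = - (LINT x|lebesgue_on \<Omega>. (G x \<bullet> i) * \<eta> x)"
    "(LINT x|lebesgue_on \<Omega>. v x * partial_deriv i \<eta> x) = - (LINT x|lebesgue_on \<Omega>. (K x \<bullet> i) * \<eta> x)"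
    using assms(5,6) e i unfolding is_weak_grad_def by blast+
  then show "(LINT x|lebesgue_on \<Omega>. (u x + v x) * partial_deriv i \<eta> x)
      = - (LINT x|lebesgue_on \<Omega>. ((G x + K x) \<bullet> i) * \<eta> x)"
    using L2_prod_integrable[OF assms(1) d] L2_prod_integrable[OF assms(2) d]
      L2_prod_integrable[OF L2_space_component[OF assms(3) i] t]
      L2_prod_integrable[OF L2_space_component[OF assms(4) i] t]
    by (simp add: distrib_right inner_add_left)
qed

lemma is_weak_grad_mult:
  assumes "is_weak_grad \<Omega> u G"
  shows "is_weak_grad \<Omega> (\<lambda>x. c * u x) (\<lambda>x. c *\<^sub>R G x)"
  using assms unfolding is_weak_grad_def by (simp add: mult.assoc)

lemma weak_grad_L2: "u \<in> H1 \<Omega> \<Longrightarrow> weak_grad \<Omega> u \<in> L2_space \<Omega>"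
  and weak_grad_is: "u \<in> H1 \<Omega> \<Longrightarrow> is_weak_grad \<Omega> u (weak_grad \<Omega> u)"
proof -
  assume "u \<in> H1 \<Omega>"
  then have "\<exists>G. G \<in> L2_space \<Omega> \<and> is_weak_grad \<Omega> u G" by (auto simp: H1_def)
  from someI_ex[OF this] show "weak_grad \<Omega> u \<in> L2_space \<Omega>" "is_weak_grad \<Omega> u (weak_grad \<Omega> u)"
    unfolding weak_grad_def by blast+
qed

lemma H1_L2: "u \<in> H1 \<Omega> \<Longrightarrow> u \<in> L2_space \<Omega>"
  by (simp add: H1_def)

lemma H1_I: "u \<in> L2_space \<Omega> \<Longrightarrow> G \<in> L2_space \<Omega> \<Longrightarrow> is_weak_grad \<Omega> u G \<Longrightarrow> u \<in> H1 \<Omega>"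
  by (auto simp: H1_def)

text \<open>Each component of \<open>G\<close> is orthogonal to all test functions. For \<open>G\<close> the difference of two weak
  gradients of one function this is their uniqueness.\<close>

lemma weak_grad_zero_if_AE_zero:
  assumes "AE x in lebesgue_on \<Omega>. u x = 0" "u \<in> L2_space \<Omega>" "G \<in> L2_space \<Omega>" "is_weak_grad \<Omega> u G"
  shows "AE x in lebesgue_on \<Omega>. G x = 0"
proof -
  have "AE x in lebesgue_on \<Omega>. G x \<bullet> i = 0" if i: "i \<in> Basis" for i
  proof (rule fundamental_lemma_variations[OF _ open_dom])
    show "integrable (lebesgue_on \<Omega>) (\<lambda>x. G x \<bullet> i)"
      by (rule L2_space_integrable[OF open_dom bounded_dom L2_space_component[OF assms(3) i]])
    fix \<eta> assume e: "\<eta> \<in> test_funs \<Omega>"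
    have "AE x in lebesgue_on \<Omega>. u x * partial_deriv i \<eta> x = 0"
      using assms(1) by eventually_elim simp
    then have "(LINT x|lebesgue_on \<Omega>. u x * partial_deriv i \<eta> x) = 0"
      by (rule integral_eq_zero_AE)
    moreover have "(LINT x|lebesgue_on \<Omega>. u x * partial_deriv i \<eta> x)
        = - (LINT x|lebesgue_on \<Omega>. (G x \<bullet> i) * \<eta> x)"
      using assms(4) e i unfolding is_weak_grad_def by blast
    ultimately show "(LINT x|lebesgue_on \<Omega>. (G x \<bullet> i) * \<eta> x) = 0" by simp
  qed
  then have "AE x in lebesgue_on \<Omega>. \<forall>i\<in>Basis. G x \<bullet> i = 0"
    by (intro AE_finite_allI) auto
  then show ?thesis
    by eventually_elim (rule euclidean_eqI, simp)
qed

lemma weak_grad_AE_unique: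
  assumes "u \<in> L2_space \<Omega>" "G \<in> L2_space \<Omega>" "is_weak_grad \<Omega> u G"
  shows "AE x in lebesgue_on \<Omega>. weak_grad \<Omega> u x = G x"
proof -
  have u: "u \<in> H1 \<Omega>" using assms by (rule H1_I)
  have "is_weak_grad \<Omega> (\<lambda>x. u x + (-1) * u x) (\<lambda>x. weak_grad \<Omega> u x + (-1) *\<^sub>R G x)"
    by (intro is_weak_grad_add is_weak_grad_mult assms L2_space_mult L2_space_scaleR weak_grad_L2
        weak_grad_is u)
  then have "AE x in lebesgue_on \<Omega>. weak_grad \<Omega> u x + (-1) *\<^sub>R G x = 0"
    by (rule weak_grad_zero_if_AE_zero[rotated 3])
      (auto intro!: L2_space_diff assms weak_grad_L2 u simp: L2_space_zero)
  then show ?thesis by eventually_elim simp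
qed

lemma H1_add:
  assumes "u \<in> H1 \<Omega>" "v \<in> H1 \<Omega>"
  shows "(\<lambda>x. u x + v x) \<in> H1 \<Omega>"
    and "AE x in lebesgue_on \<Omega>. weak_grad \<Omega> (\<lambda>x. u x + v x) x = weak_grad \<Omega> u x + weak_grad \<Omega> v x"
proof -
  note l = L2_space_add[OF H1_L2[OF assms(1)] H1_L2[OF assms(2)]]
    L2_space_add[OF weak_grad_L2[OF assms(1)] weak_grad_L2[OF assms(2)]]
    is_weak_grad_add[OF H1_L2[OF assms(1)] H1_L2[OF assms(2)] weak_grad_L2[OF assms(1)]
      weak_grad_L2[OF assms(2)] weak_grad_is[OF assms(1)] weak_grad_is[OF assms(2)]]
  show "(\<lambda>x. u x + v x) \<in> H1 \<Omega>" by (rule H1_I[OF l])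
  show "AE x in lebesgue_on \<Omega>. weak_grad \<Omega> (\<lambda>x. u x + v x) x = weak_grad \<Omega> u x + weak_grad \<Omega> v x"
    by (rule weak_grad_AE_unique[OF l])
qed

lemma H1_mult:
  assumes "u \<in> H1 \<Omega>"
  shows "(\<lambda>x. c * u x) \<in> H1 \<Omega>"
    and "AE x in lebesgue_on \<Omega>. weak_grad \<Omega> (\<lambda>x. c * u x) x = c *\<^sub>R weak_grad \<Omega> u x"
proof -
  note l = L2_space_mult[OF H1_L2[OF assms], of c] L2_space_scaleR[OF weak_grad_L2[OF assms], of c]
    is_weak_grad_mult[OF weak_grad_is[OF assms], of c]
  show "(\<lambda>x. c * u x) \<in> H1 \<Omega>" by (rule H1_I[OF l])
  show "AE x in lebesgue_on \<Omega>. weak_grad \<Omega> (\<lambda>x. c * u x) x = c *\<^sub>R weak_grad \<Omega> u x"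
    by (rule weak_grad_AE_unique[OF l])
qed

lemma H1_diff:
  assumes "u \<in> H1 \<Omega>" "v \<in> H1 \<Omega>"
  shows "(\<lambda>x. u x - v x) \<in> H1 \<Omega>"
    and "AE x in lebesgue_on \<Omega>. weak_grad \<Omega> (\<lambda>x. u x - v x) x = weak_grad \<Omega> u x - weak_grad \<Omega> v x"
proof -
  note a = H1_add[OF assms(1) H1_mult(1)[OF assms(2), of "-1"]]
  show "(\<lambda>x. u x - v x) \<in> H1 \<Omega>" using a(1) by simp
  show "AE x in lebesgue_on \<Omega>. weak_grad \<Omega> (\<lambda>x. u x - v x) x = weak_grad \<Omega> u x - weak_grad \<Omega> v x"
    using a(2) H1_mult(2)[OF assms(2), of "-1"] by eventually_elim simp
qed

lemma test_fun_H1: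
  assumes e: "\<eta> \<in> test_funs \<Omega>"
  shows "\<eta> \<in> H1 \<Omega>" and "AE x in lebesgue_on \<Omega>. weak_grad \<Omega> \<eta> x = classical_grad \<eta> x"
    and "classical_grad \<eta> \<in> L2_space \<Omega>"
proof -
  have s: "smooth_fun \<eta>" using e by (simp add: test_funs_def)
  show l: "classical_grad \<eta> \<in> L2_space \<Omega>"
  proof -
    have "(\<lambda>x. \<Sum>i\<in>A. partial_deriv i \<eta> x *\<^sub>R i) \<in> L2_space \<Omega>" if "A \<subseteq> Basis" "finite A" for A :: "'a set"
      using that(2,1)
    proof (induction A rule: finite_induct)
      case empty
      then show ?case by (simp add: L2_space_zero)
    next
      case (insert i A)
      then have "(\<lambda>x. partial_deriv i \<eta> x) \<in> L2_space \<Omega>"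
        using test_fun_partial_deriv_L2[OF e] by auto
      then have "(\<lambda>x. partial_deriv i \<eta> x *\<^sub>R i) \<in> L2_space \<Omega>"
        using insert.prems by (auto simp: L2_space_def)
      then show ?case using insert by (simp add: L2_space_add)
    qed
    then show ?thesis unfolding classical_grad_def[abs_def] by simp
  qed
  have w: "is_weak_grad \<Omega> \<eta> (classical_grad \<eta>)"
    unfolding is_weak_grad_def
  proof (intro ballI)
    fix \<zeta> and i :: 'a assume z: "\<zeta> \<in> test_funs \<Omega>" and i: "i \<in> Basis"
    show "(LINT x|lebesgue_on \<Omega>. \<eta> x * partial_deriv i \<zeta> x)
        = - (LINT x|lebesgue_on \<Omega>. (classical_grad \<eta> x \<bullet> i) * \<zeta> x)"
      unfolding classical_grad_inner_Basis[OF i] unfolding partial_deriv_def[of i \<eta>]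
      using smooth_fun_partial_deriv_continuous[OF s i, unfolded partial_deriv_def]
      by (intro test_fun_ibp[OF open_dom z i smooth_fun_has_derivative[OF s]])
  qed
  show "\<eta> \<in> H1 \<Omega>" by (rule H1_I[OF test_fun_L2[OF e] l w])
  show "AE x in lebesgue_on \<Omega>. weak_grad \<Omega> \<eta> x = classical_grad \<eta> x"
    by (rule weak_grad_AE_unique[OF test_fun_L2[OF e] l w])
qed

section \<open>The Poincare inequality\<close>

text \<open>For a unit coordinate vector \<open>e\<close>, integrating \<open>\<partial>\<^sub>e ((x \<bullet> e) \<eta>\<^sup>2)\<close> gives
  \<open>\<parallel>\<eta>\<parallel>\<^sup>2 = - 2 \<integral> (x \<bullet> e) \<eta> \<partial>\<^sub>e\<eta>\<close>, and \<open>x \<bullet> e\<close> is bounded on the domain.\<close>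

lemma poincare_test_funs:
  "\<exists>C\<ge>0. \<forall>\<eta>\<in>test_funs \<Omega>. L2_norm \<Omega> \<eta> \<le> C * L2_norm \<Omega> (classical_grad \<eta>)"
proof -
  obtain e :: 'a where e: "e \<in> Basis" using nonempty_Basis by blast
  obtain R where R: "\<And>x. x \<in> \<Omega> \<Longrightarrow> norm x \<le> R" using bounded_dom unfolding bounded_iff by blast
  have "L2_norm \<Omega> \<eta> \<le> (2 * \<bar>R\<bar>) * L2_norm \<Omega> (classical_grad \<eta>)" if h: "\<eta> \<in> test_funs \<Omega>" for \<eta>
  proof -
    have s: "smooth_fun \<eta>" and K: "compact (closure {x. \<eta> x \<noteq> 0})" using h by (simp_all add: test_funs_def)
    define a where "a = (\<lambda>x. (x \<bullet> e) * partial_deriv e \<eta> x)"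
    have ca: "continuous_on UNIV a"
      unfolding a_def
      by (intro continuous_on_mult continuous_on_inner continuous_on_id continuous_on_const
          smooth_fun_partial_deriv_continuous[OF s e])
    have aL: "a \<in> L2_space \<Omega>"
    proof (rule continuous_compact_support_L2[OF ca K])
      show "a x = 0" if "x \<notin> closure {x. \<eta> x \<noteq> 0}" for x
        using test_fun_partial_deriv_outside[OF that] by (simp add: a_def)
    qed
    note hL = test_fun_L2[OF h]
    have der: "((\<lambda>x. (x \<bullet> e) * \<eta> x) has_derivative
        (\<lambda>v. (x \<bullet> e) * frechet_derivative \<eta> (at x) v + (v \<bullet> e) * \<eta> x)) (at x)" for x
      by (rule has_derivative_mult[OF _ smooth_fun_has_derivative[OF s]])
        (auto intro!: derivative_eq_intros)
    have eq: "(x \<bullet> e) * frechet_derivative \<eta> (at x) e + (e \<bullet> e) * \<eta> x = a x + \<eta> x" for x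
      using e by (simp add: a_def partial_deriv_def)
    have "(LINT x|lebesgue_on \<Omega>. ((x \<bullet> e) * \<eta> x) * partial_deriv e \<eta> x)
        = - (LINT x|lebesgue_on \<Omega>. (a x + \<eta> x) * \<eta> x)"
      using continuous_on_add[OF ca smooth_fun_continuous[OF s]]
      unfolding eq[symmetric] by (rule test_fun_ibp[OF open_dom h e der])
    moreover have "(LINT x|lebesgue_on \<Omega>. ((x \<bullet> e) * \<eta> x) * partial_deriv e \<eta> x) = L2_inner \<Omega> a \<eta>"
      by (simp add: L2_inner_def a_def mult_ac)
    moreover have "(LINT x|lebesgue_on \<Omega>. (a x + \<eta> x) * \<eta> x) = L2_inner \<Omega> a \<eta> + L2_inner \<Omega> \<eta> \<eta>"
      using L2_inner_add_left[OF aL hL hL] by (simp add: L2_inner_def)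
    ultimately have "(L2_norm \<Omega> \<eta>)\<^sup>2 \<le> 2 * \<bar>L2_inner \<Omega> a \<eta>\<bar>"
      unfolding L2_norm_square by linarith
    also have "\<dots> \<le> 2 * (L2_norm \<Omega> a * L2_norm \<Omega> \<eta>)"
      using L2_Cauchy_Schwarz[OF aL hL] by simp
    finally have sq: "L2_norm \<Omega> \<eta> * L2_norm \<Omega> \<eta> \<le> (2 * L2_norm \<Omega> a) * L2_norm \<Omega> \<eta>"
      by (simp add: power2_eq_square)
    have le1: "L2_norm \<Omega> \<eta> \<le> 2 * L2_norm \<Omega> a"
    proof (cases "L2_norm \<Omega> \<eta> = 0")
      case True
      then show ?thesis using L2_norm_nonneg[of \<Omega> a] by simp
    next
      case False
      then show ?thesis using sq L2_norm_nonneg[of \<Omega> \<eta>] mult_right_le_imp_le[OF sq] by linarith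
    qed
    have "L2_norm \<Omega> a \<le> L2_norm \<Omega> (\<lambda>x. R *\<^sub>R classical_grad \<eta> x)"
    proof (rule L2_norm_mono[OF aL L2_space_scaleR[OF test_fun_H1(3)[OF h]]], rule AE_I2)
      fix x assume "x \<in> space (lebesgue_on \<Omega>)"
      then have x: "norm x \<le> R" using R by simp
      have "\<bar>x \<bullet> e\<bar> * \<bar>partial_deriv e \<eta> x\<bar> \<le> \<bar>R\<bar> * norm (classical_grad \<eta> x)"
      proof (rule mult_mono)
        show "\<bar>x \<bullet> e\<bar> \<le> \<bar>R\<bar>" using Basis_le_norm[OF e, of x] x by simp
        show "\<bar>partial_deriv e \<eta> x\<bar> \<le> norm (classical_grad \<eta> x)"
          using Basis_le_norm[OF e, of "classical_grad \<eta> x"] classical_grad_inner_Basis[OF e, of \<eta> x] by simp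
      qed simp_all
      then show "norm (a x) \<le> norm (R *\<^sub>R classical_grad \<eta> x)"
        by (simp add: a_def abs_mult)
    qed
    then have "L2_norm \<Omega> a \<le> \<bar>R\<bar> * L2_norm \<Omega> (classical_grad \<eta>)"
      by (simp only: L2_norm_scaleR)
    then show ?thesis using le1 by linarith
  qed
  then show ?thesis by (intro exI[of _ "2 * \<bar>R\<bar>"]) auto
qed

lemma L2_norm_le_H1_norm: "L2_norm \<Omega> u \<le> H1_norm \<Omega> u"
  unfolding H1_norm_def by (rule real_le_rsqrt) simp

lemma L2_norm_weak_grad_le_H1_norm: "L2_norm \<Omega> (weak_grad \<Omega> u) \<le> H1_norm \<Omega> u"
  unfolding H1_norm_def by (rule real_le_rsqrt) simp

lemma H1_norm_nonneg: "0 \<le> H1_norm \<Omega> u"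
  by (simp add: H1_norm_def)

lemma H1_norm_le_sum: "H1_norm \<Omega> u \<le> L2_norm \<Omega> u + L2_norm \<Omega> (weak_grad \<Omega> u)"
  unfolding H1_norm_def by (rule sqrt_sum_squares_le_sum) (simp_all add: L2_norm_nonneg)

lemma L2_norm_weak_grad_add:
  assumes "u \<in> H1 \<Omega>" "v \<in> H1 \<Omega>"
  shows "L2_norm \<Omega> (weak_grad \<Omega> (\<lambda>x. u x + v x))
           \<le> L2_norm \<Omega> (weak_grad \<Omega> u) + L2_norm \<Omega> (weak_grad \<Omega> v)"
proof -
  note g = weak_grad_L2[OF assms(1)] weak_grad_L2[OF assms(2)]
  have "L2_norm \<Omega> (weak_grad \<Omega> (\<lambda>x. u x + v x)) = L2_norm \<Omega> (\<lambda>x. weak_grad \<Omega> u x + weak_grad \<Omega> v x)"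
    by (rule L2_norm_cong[OF weak_grad_L2[OF H1_add(1)[OF assms]] L2_space_add[OF g] H1_add(2)[OF assms]])
  then show ?thesis using L2_norm_triangle[OF g] by simp
qed

lemma L2_norm_weak_grad_mult:
  assumes "u \<in> H1 \<Omega>"
  shows "L2_norm \<Omega> (weak_grad \<Omega> (\<lambda>x. c * u x)) = \<bar>c\<bar> * L2_norm \<Omega> (weak_grad \<Omega> u)"
  using L2_norm_cong[OF weak_grad_L2[OF H1_mult(1)[OF assms]] L2_space_scaleR[OF weak_grad_L2[OF assms]]
      H1_mult(2)[OF assms], of c] L2_norm_scaleR[of \<Omega> c "weak_grad \<Omega> u"] by simp

lemma L2_norm_weak_grad_diff:
  assumes "u \<in> H1 \<Omega>" "v \<in> H1 \<Omega>"
  shows "L2_norm \<Omega> (weak_grad \<Omega> (\<lambda>x. u x - v x)) = L2_norm \<Omega> (\<lambda>x. weak_grad \<Omega> u x - weak_grad \<Omega> v x)"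
  by (rule L2_norm_cong[OF weak_grad_L2[OF H1_diff(1)[OF assms]]
        L2_space_diff[OF weak_grad_L2[OF assms(1)] weak_grad_L2[OF assms(2)]] H1_diff(2)[OF assms]])

text \<open>The constant is not optimal, but this form suffices for limits of null sequences.\<close>

lemma H1_norm_add:
  assumes "u \<in> H1 \<Omega>" "v \<in> H1 \<Omega>"
  shows "H1_norm \<Omega> (\<lambda>x. u x + v x) \<le> 2 * (H1_norm \<Omega> u + H1_norm \<Omega> v)"
proof -
  have "H1_norm \<Omega> (\<lambda>x. u x + v x)
      \<le> L2_norm \<Omega> (\<lambda>x. u x + v x) + L2_norm \<Omega> (weak_grad \<Omega> (\<lambda>x. u x + v x))"
    by (rule H1_norm_le_sum)
  also have "\<dots> \<le> (L2_norm \<Omega> u + L2_norm \<Omega> v) + (L2_norm \<Omega> (weak_grad \<Omega> u) + L2_norm \<Omega> (weak_grad \<Omega> v))"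
    by (intro add_mono L2_norm_weak_grad_add[OF assms] L2_norm_triangle H1_L2 assms)
  also have "\<dots> \<le> (H1_norm \<Omega> u + H1_norm \<Omega> v) + (H1_norm \<Omega> u + H1_norm \<Omega> v)"
    by (intro add_mono L2_norm_le_H1_norm L2_norm_weak_grad_le_H1_norm)
  finally show ?thesis by simp
qed

lemma H1_norm_mult:
  assumes "u \<in> H1 \<Omega>"
  shows "H1_norm \<Omega> (\<lambda>x. c * u x) = \<bar>c\<bar> * H1_norm \<Omega> u"
proof -
  have "L2_norm \<Omega> (\<lambda>x. c * u x) = \<bar>c\<bar> * L2_norm \<Omega> u"
    using L2_norm_scaleR[of \<Omega> c u] by simp
  then have "H1_norm \<Omega> (\<lambda>x. c * u x)
      = sqrt (c\<^sup>2 * ((L2_norm \<Omega> u)\<^sup>2 + (L2_norm \<Omega> (weak_grad \<Omega> u))\<^sup>2))"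
    unfolding H1_norm_def L2_norm_weak_grad_mult[OF assms] by (simp add: power_mult_distrib distrib_left)
  then show ?thesis by (simp add: H1_norm_def real_sqrt_mult)
qed

lemma H10_H1: "u \<in> H10 \<Omega> \<Longrightarrow> u \<in> H1 \<Omega>"
  by (simp add: H10_def)

lemma H10_I:
  fixes \<eta> :: "nat \<Rightarrow> 'a \<Rightarrow> real"
  assumes "u \<in> H1 \<Omega>" "\<And>n. \<eta> n \<in> test_funs \<Omega>" "(\<lambda>n. H1_norm \<Omega> (\<lambda>x. u x - \<eta> n x)) \<longlonglongrightarrow> 0"
  shows "u \<in> H10 \<Omega>"
proof -
  have "range \<eta> \<subseteq> test_funs \<Omega>" using assms(2) by (rule image_subsetI)
  with assms(1,3) show ?thesis unfolding H10_def mem_Collect_eq by (intro conjI exI[of _ \<eta>])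
qed

lemma H10_E:
  assumes "u \<in> H10 \<Omega>"
  obtains \<eta> :: "nat \<Rightarrow> 'a \<Rightarrow> real" where "\<And>n. \<eta> n \<in> test_funs \<Omega>"
    "(\<lambda>n. H1_norm \<Omega> (\<lambda>x. u x - \<eta> n x)) \<longlonglongrightarrow> 0"
  using assms that unfolding H10_def image_subset_iff by blast

lemma H10_add:
  assumes "u \<in> H10 \<Omega>" "v \<in> H10 \<Omega>"
  shows "(\<lambda>x. u x + v x) \<in> H10 \<Omega>"
proof -
  obtain \<eta> where en: "\<And>n. \<eta> n \<in> test_funs \<Omega>" and e: "(\<lambda>n. H1_norm \<Omega> (\<lambda>x. u x - \<eta> n x)) \<longlonglongrightarrow> 0"
    by (rule H10_E[OF assms(1)]) blast
  obtain \<zeta> where zn: "\<And>n. \<zeta> n \<in> test_funs \<Omega>" and z: "(\<lambda>n. H1_norm \<Omega> (\<lambda>x. v x - \<zeta> n x)) \<longlonglongrightarrow> 0"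
    by (rule H10_E[OF assms(2)]) blast
  have b: "H1_norm \<Omega> (\<lambda>x. (u x + v x) - (\<eta> n x + \<zeta> n x))
      \<le> 2 * (H1_norm \<Omega> (\<lambda>x. u x - \<eta> n x) + H1_norm \<Omega> (\<lambda>x. v x - \<zeta> n x))" for n
    using H1_norm_add[OF H1_diff(1)[OF H10_H1[OF assms(1)] test_fun_H1(1)[OF en[of n]]]
        H1_diff(1)[OF H10_H1[OF assms(2)] test_fun_H1(1)[OF zn[of n]]]]
    by (simp add: add_diff_add)
  have "(\<lambda>n. 2 * (H1_norm \<Omega> (\<lambda>x. u x - \<eta> n x) + H1_norm \<Omega> (\<lambda>x. v x - \<zeta> n x))) \<longlonglongrightarrow> 2 * (0 + 0)"
    by (intro tendsto_intros e z)
  then have "(\<lambda>n. 2 * (H1_norm \<Omega> (\<lambda>x. u x - \<eta> n x) + H1_norm \<Omega> (\<lambda>x. v x - \<zeta> n x))) \<longlonglongrightarrow> 0"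
    by simp
  then have "(\<lambda>n. H1_norm \<Omega> (\<lambda>x. (u x + v x) - (\<eta> n x + \<zeta> n x))) \<longlonglongrightarrow> 0"
  proof (rule Lim_null_comparison[rotated], intro always_eventually allI)
    show "norm (H1_norm \<Omega> (\<lambda>x. (u x + v x) - (\<eta> n x + \<zeta> n x)))
        \<le> 2 * (H1_norm \<Omega> (\<lambda>x. u x - \<eta> n x) + H1_norm \<Omega> (\<lambda>x. v x - \<zeta> n x))" for n
      using b[of n] H1_norm_nonneg by (simp only: real_norm_def abs_of_nonneg)
  qed
  then show ?thesis
    by (rule H10_I[OF H1_add(1)[OF H10_H1[OF assms(1)] H10_H1[OF assms(2)]] test_funs_add[OF en zn]])
qed

lemma H10_mult:
  assumes "u \<in> H10 \<Omega>"
  shows "(\<lambda>x. c * u x) \<in> H10 \<Omega>"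
proof -
  obtain \<eta> where en: "\<And>n. \<eta> n \<in> test_funs \<Omega>" and e: "(\<lambda>n. H1_norm \<Omega> (\<lambda>x. u x - \<eta> n x)) \<longlonglongrightarrow> 0"
    by (rule H10_E[OF assms]) blast
  have b: "H1_norm \<Omega> (\<lambda>x. c * u x - c * \<eta> n x) = \<bar>c\<bar> * H1_norm \<Omega> (\<lambda>x. u x - \<eta> n x)" for n
    using H1_norm_mult[OF H1_diff(1)[OF H10_H1[OF assms] test_fun_H1(1)[OF en[of n]]], of c]
    by (simp only: right_diff_distrib)
  have "(\<lambda>n. \<bar>c\<bar> * H1_norm \<Omega> (\<lambda>x. u x - \<eta> n x)) \<longlonglongrightarrow> \<bar>c\<bar> * 0"
    by (intro tendsto_intros e)
  then have "(\<lambda>n. H1_norm \<Omega> (\<lambda>x. c * u x - c * \<eta> n x)) \<longlonglongrightarrow> 0"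
    by (simp only: b mult_zero_right)
  then show ?thesis
    by (rule H10_I[OF H1_mult(1)[OF H10_H1[OF assms]] test_funs_mult[OF en]])
qed

lemma H10_diff:
  assumes "u \<in> H10 \<Omega>" "v \<in> H10 \<Omega>"
  shows "(\<lambda>x. u x - v x) \<in> H10 \<Omega>"
  using H10_add[OF assms(1) H10_mult[OF assms(2), of "-1"]] by simp

lemma test_fun_H10:
  assumes "\<eta> \<in> test_funs \<Omega>" shows "\<eta> \<in> H10 \<Omega>"
proof -
  have "H1_norm \<Omega> (\<lambda>x. 0 * \<eta> x) = 0"
    using H1_norm_mult[OF test_fun_H1(1)[OF assms], of 0] by (simp only: abs_zero mult_zero_left)
  then have "(\<lambda>n::nat. H1_norm \<Omega> (\<lambda>x. \<eta> x - \<eta> x)) \<longlonglongrightarrow> 0"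
    by (simp only: diff_self mult_zero_left tendsto_const)
  then show ?thesis by (rule H10_I[OF test_fun_H1(1)[OF assms] assms])
qed

text \<open>The inequality for test functions passes to \<open>H\<^sup>1\<close>-limits.\<close>

lemma poincare_H10:
  "\<exists>C\<ge>0. \<forall>u\<in>H10 \<Omega>. L2_norm \<Omega> u \<le> C * L2_norm \<Omega> (weak_grad \<Omega> u)"
proof -
  obtain C where C: "C \<ge> 0" "\<And>\<eta>. \<eta> \<in> test_funs \<Omega> \<Longrightarrow> L2_norm \<Omega> \<eta> \<le> C * L2_norm \<Omega> (classical_grad \<eta>)"
    using poincare_test_funs by blast
  have "L2_norm \<Omega> u \<le> C * L2_norm \<Omega> (weak_grad \<Omega> u)" if u: "u \<in> H10 \<Omega>" for u
  proof -
    obtain \<eta> where et: "\<And>n. \<eta> n \<in> test_funs \<Omega>" and e: "(\<lambda>n. H1_norm \<Omega> (\<lambda>x. u x - \<eta> n x)) \<longlonglongrightarrow> 0"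
      by (rule H10_E[OF u]) blast
    have b: "L2_norm \<Omega> u \<le> (1 + C) * H1_norm \<Omega> (\<lambda>x. u x - \<eta> n x) + C * L2_norm \<Omega> (weak_grad \<Omega> u)" for n
    proof -
      note en = et[of n]
      note eH = test_fun_H1(1)[OF en] and uH = H10_H1[OF u]
      note dH = H1_diff(1)[OF uH eH]
      have "L2_norm \<Omega> u \<le> L2_norm \<Omega> (\<lambda>x. u x - \<eta> n x) + L2_norm \<Omega> (\<eta> n)"
        using L2_norm_triangle[OF H1_L2[OF dH] H1_L2[OF eH]] by simp
      moreover have "L2_norm \<Omega> (\<eta> n) \<le> C * L2_norm \<Omega> (weak_grad \<Omega> (\<eta> n))"
        using C(2)[OF en] L2_norm_cong[OF weak_grad_L2[OF eH] test_fun_H1(3,2)[OF en]] by simp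
      moreover have "L2_norm \<Omega> (weak_grad \<Omega> (\<eta> n))
          \<le> L2_norm \<Omega> (weak_grad \<Omega> u) + L2_norm \<Omega> (weak_grad \<Omega> (\<lambda>x. u x - \<eta> n x))"
        using L2_norm_weak_grad_add[OF uH H1_mult(1)[OF dH, of "-1"]]
          L2_norm_weak_grad_mult[OF dH, of "-1"] by simp
      then have "C * L2_norm \<Omega> (weak_grad \<Omega> (\<eta> n))
          \<le> C * (L2_norm \<Omega> (weak_grad \<Omega> u) + L2_norm \<Omega> (weak_grad \<Omega> (\<lambda>x. u x - \<eta> n x)))"
        using C(1) by (rule mult_left_mono)
      moreover have "C * L2_norm \<Omega> (weak_grad \<Omega> (\<lambda>x. u x - \<eta> n x)) \<le> C * H1_norm \<Omega> (\<lambda>x. u x - \<eta> n x)"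
        by (rule mult_left_mono[OF L2_norm_weak_grad_le_H1_norm C(1)])
      ultimately show ?thesis
        using L2_norm_le_H1_norm[of "\<lambda>x. u x - \<eta> n x"] unfolding distrib_left distrib_right by linarith
    qed
    have "(\<lambda>n. (1 + C) * H1_norm \<Omega> (\<lambda>x. u x - \<eta> n x) + C * L2_norm \<Omega> (weak_grad \<Omega> u))
        \<longlonglongrightarrow> (1 + C) * 0 + C * L2_norm \<Omega> (weak_grad \<Omega> u)"
      by (intro tendsto_intros e)
    from LIMSEQ_le_const[OF this] show ?thesis using b by simp
  qed
  with C(1) show ?thesis by blast
qed

section \<open>The dual norm of a weak Laplacian\<close>

lemma neg_laplacian_add:
  assumes "u \<in> H1 \<Omega>" "v \<in> H1 \<Omega>" "w \<in> H1 \<Omega>"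
  shows "neg_laplacian \<Omega> u (\<lambda>x. v x + w x) = neg_laplacian \<Omega> u v + neg_laplacian \<Omega> u w"
proof -
  note g = weak_grad_L2[OF assms(1)] weak_grad_L2[OF assms(2)] weak_grad_L2[OF assms(3)]
  have "L2_inner \<Omega> (weak_grad \<Omega> u) (weak_grad \<Omega> (\<lambda>x. v x + w x))
      = L2_inner \<Omega> (weak_grad \<Omega> u) (\<lambda>x. weak_grad \<Omega> v x + weak_grad \<Omega> w x)"
    by (rule L2_inner_cong[OF g(1) g(1) weak_grad_L2[OF H1_add(1)[OF assms(2,3)]]
          L2_space_add[OF g(2,3)] AE_I2 H1_add(2)[OF assms(2,3)]]) (rule refl)
  then show ?thesis unfolding neg_laplacian_def L2_inner_add_right[OF g(2,3,1)] .
qed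

lemma neg_laplacian_mult:
  assumes "u \<in> H1 \<Omega>" "v \<in> H1 \<Omega>"
  shows "neg_laplacian \<Omega> u (\<lambda>x. c * v x) = c * neg_laplacian \<Omega> u v"
proof -
  note g = weak_grad_L2[OF assms(1)] weak_grad_L2[OF assms(2)]
  have "L2_inner \<Omega> (weak_grad \<Omega> u) (weak_grad \<Omega> (\<lambda>x. c * v x))
      = L2_inner \<Omega> (weak_grad \<Omega> u) (\<lambda>x. c *\<^sub>R weak_grad \<Omega> v x)"
    by (rule L2_inner_cong[OF g(1) g(1) weak_grad_L2[OF H1_mult(1)[OF assms(2)]]
          L2_space_scaleR[OF g(2)] AE_I2 H1_mult(2)[OF assms(2)]]) (rule refl)
  then show ?thesis unfolding neg_laplacian_def L2_inner_scaleR_right .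
qed

lemma neg_laplacian_commute: "neg_laplacian \<Omega> u v = neg_laplacian \<Omega> v u"
  unfolding neg_laplacian_def by (rule L2_inner_commute)

lemma neg_laplacian_diff:
  assumes "u \<in> H1 \<Omega>" "v \<in> H1 \<Omega>" "w \<in> H1 \<Omega>"
  shows "neg_laplacian \<Omega> u (\<lambda>x. v x - w x) = neg_laplacian \<Omega> u v - neg_laplacian \<Omega> u w"
  using neg_laplacian_add[OF assms(1,2) H1_mult(1)[OF assms(3)], of "-1"]
    neg_laplacian_mult[OF assms(1,3), of "-1"] by simp

lemma neg_laplacian_bound:
  assumes "u \<in> H1 \<Omega>" "v \<in> H1 \<Omega>"
  shows "\<bar>neg_laplacian \<Omega> u v\<bar> \<le> L2_norm \<Omega> (weak_grad \<Omega> u) * L2_norm \<Omega> (weak_grad \<Omega> v)"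
  unfolding neg_laplacian_def by (rule L2_Cauchy_Schwarz[OF weak_grad_L2[OF assms(1)] weak_grad_L2[OF assms(2)]])

lemma neg_laplacian_Hm1:
  assumes "u \<in> H1 \<Omega>" shows "neg_laplacian \<Omega> u \<in> Hm1 \<Omega>"
  unfolding Hm1_def
proof (intro CollectI conjI ballI allI exI)
  fix w assume w: "w \<in> H10 \<Omega>"
  show "neg_laplacian \<Omega> u (\<lambda>x. c * w x) = c * neg_laplacian \<Omega> u w" for c
    by (rule neg_laplacian_mult[OF assms H10_H1[OF w]])
  show "neg_laplacian \<Omega> u (\<lambda>x. v x + w x) = neg_laplacian \<Omega> u v + neg_laplacian \<Omega> u w"
    if "v \<in> H10 \<Omega>" for v
    by (rule neg_laplacian_add[OF assms H10_H1[OF that] H10_H1[OF w]])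
  have "\<bar>neg_laplacian \<Omega> u w\<bar> \<le> L2_norm \<Omega> (weak_grad \<Omega> u) * L2_norm \<Omega> (weak_grad \<Omega> w)"
    by (rule neg_laplacian_bound[OF assms H10_H1[OF w]])
  also have "\<dots> \<le> L2_norm \<Omega> (weak_grad \<Omega> u) * H1_norm \<Omega> w"
    by (rule mult_left_mono[OF L2_norm_weak_grad_le_H1_norm L2_norm_nonneg])
  finally show "\<bar>neg_laplacian \<Omega> u w\<bar> \<le> L2_norm \<Omega> (weak_grad \<Omega> u) * H1_norm \<Omega> w" .
qed

lemma L2_functional_Hm1:
  assumes "h \<in> L2_space \<Omega>" shows "L2_functional \<Omega> h \<in> Hm1 \<Omega>"
  unfolding Hm1_def
proof (intro CollectI conjI ballI allI exI)
  fix w assume w: "w \<in> H10 \<Omega>"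
  note wL = H1_L2[OF H10_H1[OF w]]
  show "L2_functional \<Omega> h (\<lambda>x. c * w x) = c * L2_functional \<Omega> h w" for c
    unfolding L2_functional_def by (rule L2_inner_mult_right)
  show "L2_functional \<Omega> h (\<lambda>x. v x + w x) = L2_functional \<Omega> h v + L2_functional \<Omega> h w"
    if "v \<in> H10 \<Omega>" for v
    unfolding L2_functional_def by (rule L2_inner_add_right[OF H1_L2[OF H10_H1[OF that]] wL assms])
  have "\<bar>L2_functional \<Omega> h w\<bar> \<le> L2_norm \<Omega> h * L2_norm \<Omega> w"
    unfolding L2_functional_def by (rule L2_Cauchy_Schwarz[OF assms wL])
  also have "\<dots> \<le> L2_norm \<Omega> h * H1_norm \<Omega> w"
    by (rule mult_left_mono[OF L2_norm_le_H1_norm L2_norm_nonneg])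
  finally show "\<bar>L2_functional \<Omega> h w\<bar> \<le> L2_norm \<Omega> h * H1_norm \<Omega> w" .
qed

lemma Hm1_diff:
  assumes "\<Lambda> \<in> Hm1 \<Omega>" "M \<in> Hm1 \<Omega>"
  shows "(\<lambda>w. \<Lambda> w - M w) \<in> Hm1 \<Omega>"
proof -
  obtain C where C: "\<And>w. w \<in> H10 \<Omega> \<Longrightarrow> \<bar>\<Lambda> w\<bar> \<le> C * H1_norm \<Omega> w"
    using assms(1) unfolding Hm1_def mem_Collect_eq by blast
  obtain D where D: "\<And>w. w \<in> H10 \<Omega> \<Longrightarrow> \<bar>M w\<bar> \<le> D * H1_norm \<Omega> w"
    using assms(2) unfolding Hm1_def mem_Collect_eq by blast
  show ?thesis
    unfolding Hm1_def
  proof (intro CollectI conjI ballI allI exI)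
    fix w assume w: "w \<in> H10 \<Omega>"
    show "\<Lambda> (\<lambda>x. c * w x) - M (\<lambda>x. c * w x) = c * (\<Lambda> w - M w)" for c
      using assms w unfolding Hm1_def mem_Collect_eq by (simp add: right_diff_distrib)
    show "\<Lambda> (\<lambda>x. v x + w x) - M (\<lambda>x. v x + w x) = (\<Lambda> v - M v) + (\<Lambda> w - M w)"
      if "v \<in> H10 \<Omega>" for v
      using assms w that unfolding Hm1_def mem_Collect_eq by simp
    show "\<bar>\<Lambda> w - M w\<bar> \<le> (C + D) * H1_norm \<Omega> w"
      using C[OF w] D[OF w] unfolding distrib_right by linarith
  qed
qed

text \<open>The supremum in \<open>Hm1_norm\<close> ranges over nonzero elements of \<open>H\<^sup>1\<^sub>0\<close>, and is meaningful only if there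
  are any.\<close>

lemma exists_nonzero_H10:
  assumes "\<Omega> \<noteq> {}"
  shows "\<exists>w\<in>H10 \<Omega>. \<not> (AE x in lebesgue_on \<Omega>. w x = 0)"
proof -
  obtain x where "x \<in> \<Omega>" using assms by blast
  then obtain a b where ab: "cbox a b \<subseteq> \<Omega>" "x \<in> box a b"
    using open_contains_cbox[OF open_dom] by metis
  have \<Omega>s: "\<Omega> \<inter> space lebesgue \<in> sets lebesgue" using open_dom by simp
  have "\<not> (AE x in lebesgue_on \<Omega>. box_bump a b 0 x = 0)"
  proof
    assume "AE x in lebesgue_on \<Omega>. box_bump a b 0 x = 0"
    then have "AE x in lebesgue. x \<in> \<Omega> \<longrightarrow> box_bump a b 0 x = 0"
      by (rule AE_restrict_space_iff[OF \<Omega>s, THEN iffD1])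
    then obtain N where N: "\<And>x. x \<in> space lebesgue - N \<Longrightarrow> x \<in> \<Omega> \<longrightarrow> box_bump a b 0 x = 0"
      "N \<in> null_sets lebesgue"
      using AE_E3 by blast
    have "box a b \<subseteq> N"
    proof
      fix y assume y: "y \<in> box a b"
      then have "y \<in> \<Omega>" using ab(1) box_subset_cbox[of a b] by blast
      moreover have "box_bump a b 0 y \<noteq> 0" using y by (simp only: box_bump_nonzero_iff)
      ultimately show "y \<in> N" using N(1)[of y] by auto
    qed
    then have "negligible (box a b)"
      using N(2) by (meson negligible_iff_null_sets negligible_subset)
    then show False using ab(2) by (simp add: negligible_interval)
  qed
  then show ?thesis using test_fun_H10[OF box_bump_test_funs[OF ab(1)]] by blast
qed

text \<open>By Cauchy--Schwarz the supremum is at most \<open>\<parallel>\<nabla>d\<parallel>\<close>, and it is attained at \<open>w = d\<close>. If \<open>d\<close> vanishes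
  almost everywhere it does not take part in the supremum, but then \<open>\<nabla>d = 0\<close> and all quotients
  vanish; the supremum is taken over a nonempty set because \<open>H\<^sup>1\<^sub>0\<close> contains a bump function.\<close>

lemma Hm1_norm_eq_grad_norm:
  assumes ne: "\<Omega> \<noteq> {}" and d: "d \<in> H10 \<Omega>"
    and \<Lambda>: "\<And>w. w \<in> H10 \<Omega> \<Longrightarrow> \<Lambda> w = neg_laplacian \<Omega> d w"
  shows "Hm1_norm \<Omega> \<Lambda> = L2_norm \<Omega> (weak_grad \<Omega> d)"
proof -
  let ?S = "{w \<in> H10 \<Omega>. \<not> (AE x in lebesgue_on \<Omega>. w x = 0)}"
  let ?q = "\<lambda>w. \<Lambda> w / L2_norm \<Omega> (weak_grad \<Omega> w)"
  note dH = H10_H1[OF d]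
  have S: "?S \<noteq> {}" using exists_nonzero_H10[OF ne] by blast
  have le: "?q w \<le> L2_norm \<Omega> (weak_grad \<Omega> d)" if "w \<in> ?S" for w
  proof (cases "L2_norm \<Omega> (weak_grad \<Omega> w) = 0")
    case True
    then show ?thesis by (simp add: L2_norm_nonneg)
  next
    case False
    then have pos: "L2_norm \<Omega> (weak_grad \<Omega> w) > 0" using L2_norm_nonneg[of \<Omega> "weak_grad \<Omega> w"] by simp
    have w: "w \<in> H10 \<Omega>" using that by simp
    have "\<Lambda> w \<le> L2_norm \<Omega> (weak_grad \<Omega> d) * L2_norm \<Omega> (weak_grad \<Omega> w)"
      using neg_laplacian_bound[OF dH H10_H1[OF w]] \<Lambda>[OF w] by linarith
    then show ?thesis using pos by (simp only: pos_divide_le_eq)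
  qed
  then have bdd: "bdd_above (?q ` ?S)" by (intro bdd_aboveI2)
  have "(SUP w\<in>?S. ?q w) \<le> L2_norm \<Omega> (weak_grad \<Omega> d)"
    using S le by (rule cSUP_least)
  moreover have "L2_norm \<Omega> (weak_grad \<Omega> d) \<le> (SUP w\<in>?S. ?q w)"
  proof (cases "d \<in> ?S")
    case True
    have "?q d = L2_norm \<Omega> (weak_grad \<Omega> d)"
      unfolding \<Lambda>[OF d] neg_laplacian_def L2_norm_square[symmetric] power2_eq_square by simp
    then show ?thesis using cSUP_upper[OF True bdd] by simp
  next
    case False
    then have "AE x in lebesgue_on \<Omega>. d x = 0" using d by simp
    then have "AE x in lebesgue_on \<Omega>. weak_grad \<Omega> d x = 0"
      by (rule weak_grad_zero_if_AE_zero[OF _ H1_L2[OF dH] weak_grad_L2[OF dH] weak_grad_is[OF dH]])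
    then have 0: "L2_norm \<Omega> (weak_grad \<Omega> d) = 0"
      using L2_norm_eq_0_iff[OF weak_grad_L2[OF dH]] by blast
    obtain w where w: "w \<in> ?S" using S by blast
    then have wH: "w \<in> H10 \<Omega>" by simp
    have "\<Lambda> w = 0" using neg_laplacian_bound[OF dH H10_H1[OF wH]] \<Lambda>[OF wH] 0 by simp
    then show ?thesis using cSUP_upper[OF w bdd] 0 by simp
  qed
  ultimately show ?thesis unfolding Hm1_norm_def by linarith
qed

section \<open>The Dirichlet energy and its constrained minimizer\<close>

lemma dirichlet_energy_eq:
  "dirichlet_energy \<Omega> f u = 1/2 * neg_laplacian \<Omega> u u - L2_inner \<Omega> f u"
  unfolding dirichlet_energy_def neg_laplacian_def L2_inner_def
  by (simp only: power2_norm_eq_inner inner_real_def)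

lemma neg_laplacian_self_nonneg: "0 \<le> neg_laplacian \<Omega> w w"
  unfolding neg_laplacian_def by (rule L2_inner_self_nonneg)

text \<open>The energy is quadratic, so its Taylor expansion of order two is exact.\<close>

lemma dirichlet_energy_add:
  assumes f: "f \<in> L2_space \<Omega>" and u: "u \<in> H1 \<Omega>" and w: "w \<in> H1 \<Omega>"
  shows "dirichlet_energy \<Omega> f (\<lambda>x. u x + w x)
    = dirichlet_energy \<Omega> f u + (neg_laplacian \<Omega> u w - L2_inner \<Omega> f w) + 1/2 * neg_laplacian \<Omega> w w"
proof -
  note uw = H1_add(1)[OF u w]
  have "neg_laplacian \<Omega> (\<lambda>x. u x + w x) (\<lambda>x. u x + w x)
      = neg_laplacian \<Omega> (\<lambda>x. u x + w x) u + neg_laplacian \<Omega> (\<lambda>x. u x + w x) w"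
    by (rule neg_laplacian_add[OF uw u w])
  also have "neg_laplacian \<Omega> (\<lambda>x. u x + w x) u = neg_laplacian \<Omega> u u + neg_laplacian \<Omega> u w"
    unfolding neg_laplacian_commute[of "\<lambda>x. u x + w x"] by (rule neg_laplacian_add[OF u u w])
  also have "neg_laplacian \<Omega> (\<lambda>x. u x + w x) w = neg_laplacian \<Omega> u w + neg_laplacian \<Omega> w w"
    unfolding neg_laplacian_commute[of "\<lambda>x. u x + w x"] neg_laplacian_commute[of u w]
    by (rule neg_laplacian_add[OF w u w])
  finally show ?thesis
    unfolding dirichlet_energy_eq L2_inner_add_right[OF H1_L2[OF u] H1_L2[OF w] f] by argo
qed

lemma dirichlet_energy_diff:
  assumes f: "f \<in> L2_space \<Omega>" and u: "u \<in> H1 \<Omega>" and v: "v \<in> H1 \<Omega>"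
  shows "dirichlet_energy \<Omega> f v = dirichlet_energy \<Omega> f u
    + (neg_laplacian \<Omega> u (\<lambda>x. v x - u x) - L2_inner \<Omega> f (\<lambda>x. v x - u x))
    + 1/2 * neg_laplacian \<Omega> (\<lambda>x. v x - u x) (\<lambda>x. v x - u x)"
  using dirichlet_energy_add[OF f u H1_diff(1)[OF v u]] by simp

lemma H1g_H1: "u \<in> H1g \<Omega> g \<Longrightarrow> u \<in> H1 \<Omega>"
  by (simp add: H1g_def)

lemma H1g_diff_H10:
  assumes "u \<in> H1g \<Omega> g" "v \<in> H1g \<Omega> g"
  shows "(\<lambda>x. u x - v x) \<in> H10 \<Omega>"
proof -
  have "(\<lambda>x. (u x - g x) - (v x - g x)) \<in> H10 \<Omega>"
    using assms unfolding H1g_def by (intro H10_diff[of "\<lambda>x. u x - g x" "\<lambda>x. v x - g x"]) simp_all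
  then show ?thesis by simp
qed

lemma admissible_convex_combination:
  assumes u: "u \<in> admissible \<Omega> \<phi> g" and v: "v \<in> admissible \<Omega> \<phi> g" and t: "0 \<le> t" "t \<le> 1"
  shows "(\<lambda>x. u x + t * (v x - u x)) \<in> admissible \<Omega> \<phi> g"
proof -
  have ug: "u \<in> H1g \<Omega> g" and vg: "v \<in> H1g \<Omega> g"
    and ae: "AE x in lebesgue_on \<Omega>. u x \<ge> \<phi> x" "AE x in lebesgue_on \<Omega>. v x \<ge> \<phi> x"
    using u v by (simp_all add: admissible_def)
  note d = H10_mult[OF H1g_diff_H10[OF vg ug], of t]
  have "(\<lambda>x. (u x - g x) + t * (v x - u x)) \<in> H10 \<Omega>"
    using ug unfolding H1g_def by (intro H10_add[OF _ d]) simp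
  then have "(\<lambda>x. (u x + t * (v x - u x)) - g x) \<in> H10 \<Omega>"
    by (simp only: add_diff_eq diff_add_eq)
  moreover have "(\<lambda>x. u x + t * (v x - u x)) \<in> H1 \<Omega>"
    by (rule H1_add(1)[OF H1g_H1[OF ug] H10_H1[OF d]])
  moreover have "AE x in lebesgue_on \<Omega>. u x + t * (v x - u x) \<ge> \<phi> x"
    using ae
  proof eventually_elim
    case (elim x)
    have "\<phi> x = (1 - t) * \<phi> x + t * \<phi> x" by (simp add: left_diff_distrib)
    also have "\<dots> \<le> (1 - t) * u x + t * v x"
      using elim t by (intro add_mono mult_left_mono) simp_all
    finally show ?case by (simp add: algebra_simps)
  qed
  ultimately show ?thesis unfolding admissible_def H1g_def by simp
qed

text \<open>Divide by \<open>t\<close> and let \<open>t\<close> tend to \<open>0\<close>.\<close>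

lemma linear_coeff_nonneg:
  fixes A B :: real
  assumes B: "B \<ge> 0" and h: "\<And>t. 0 < t \<Longrightarrow> t \<le> 1 \<Longrightarrow> 0 \<le> t * A + t\<^sup>2 * B / 2"
  shows "0 \<le> A"
proof (rule ccontr)
  assume "\<not> 0 \<le> A"
  then have A: "A < 0" by simp
  (* So small that the quadratic term is at most half of the linear one. *)
  define t where "t = min 1 (- A / (B + 1))"
  have t: "0 < t" "t \<le> 1" using A B divide_neg_pos[OF A, of "B + 1"] by (simp_all add: t_def)
  have "t \<le> - A / (B + 1)" by (simp add: t_def)
  then have "t * (B + 1) \<le> - A" using B by (subst (asm) pos_le_divide_eq) simp_all
  then have "t * B \<le> - A" using t by (simp add: distrib_left)
  then have "A + t * B / 2 < 0" using A by simp
  then have "t * (A + t * B / 2) < 0" using t(1) by (simp add: mult_pos_neg)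
  then show False using h[OF t] by (simp add: power2_eq_square distrib_left)
qed

text \<open>Moving from the minimizer towards another admissible function changes the energy to first
  order by a nonnegative amount: the variational inequality of the obstacle problem.\<close>

lemma obstacle_variational_inequality:
  assumes f: "f \<in> L2_space \<Omega>"
    and min: "is_arg_min (dirichlet_energy \<Omega> f) (\<lambda>v. v \<in> admissible \<Omega> \<phi> g) ustar"
    and v: "v \<in> admissible \<Omega> \<phi> g"
  shows "0 \<le> neg_laplacian \<Omega> ustar (\<lambda>x. v x - ustar x) - L2_inner \<Omega> f (\<lambda>x. v x - ustar x)"
proof -
  have us: "ustar \<in> admissible \<Omega> \<phi> g"
    and le: "\<And>w. w \<in> admissible \<Omega> \<phi> g \<Longrightarrow> dirichlet_energy \<Omega> f ustar \<le> dirichlet_energy \<Omega> f w"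
    using min by (auto simp: is_arg_min_linorder)
  have uH: "ustar \<in> H1 \<Omega>" and vH: "v \<in> H1 \<Omega>"
    using us v by (simp_all add: admissible_def H1g_def)
  let ?w = "\<lambda>x. v x - ustar x"
  note wH = H1_diff(1)[OF vH uH]
  show ?thesis
  proof (rule linear_coeff_nonneg[OF neg_laplacian_self_nonneg])
    fix t :: real assume t: "0 < t" "t \<le> 1"
    note twH = H1_mult(1)[OF wH, of t]
    have ww: "neg_laplacian \<Omega> (\<lambda>x. t * ?w x) (\<lambda>x. t * ?w x) = t\<^sup>2 * neg_laplacian \<Omega> ?w ?w"
      unfolding neg_laplacian_mult[OF twH wH] neg_laplacian_commute[of "\<lambda>x. t * ?w x"]
        neg_laplacian_mult[OF wH wH] by (simp add: power2_eq_square)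
    have "dirichlet_energy \<Omega> f ustar \<le> dirichlet_energy \<Omega> f (\<lambda>x. ustar x + t * ?w x)"
      using t by (intro le admissible_convex_combination us v) simp_all
    then show "0 \<le> t * (neg_laplacian \<Omega> ustar ?w - L2_inner \<Omega> f ?w) + t\<^sup>2 * neg_laplacian \<Omega> ?w ?w / 2"
      unfolding dirichlet_energy_add[OF f uH twH] ww neg_laplacian_mult[OF uH wH] L2_inner_mult_right
      by (simp add: right_diff_distrib)
  qed
qed

text \<open>In the expansion of the energy at the minimizer the first-order term is nonnegative by the
  variational inequality, so the gap is at least the quadratic term.\<close>

lemma grad_error_le_energy_gap:
  assumes f: "f \<in> L2_space \<Omega>"
    and min: "is_arg_min (dirichlet_energy \<Omega> f) (\<lambda>v. v \<in> admissible \<Omega> \<phi> g) ustar"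
    and v: "v \<in> admissible \<Omega> \<phi> g"
  shows "1/2 * (L2_norm \<Omega> (weak_grad \<Omega> (\<lambda>x. v x - ustar x)))\<^sup>2
           \<le> dirichlet_energy \<Omega> f v - dirichlet_energy \<Omega> f ustar"
proof -
  have uH: "ustar \<in> H1 \<Omega>" and vH: "v \<in> H1 \<Omega>"
    using min v by (simp_all add: is_arg_min_def admissible_def H1g_def)
  show ?thesis
    using dirichlet_energy_diff[OF f uH vH] obstacle_variational_inequality[OF f min v]
    unfolding L2_norm_square neg_laplacian_def by linarith
qed

section \<open>The entropy divergence\<close>

lemma Linf_exp:
  assumes "p \<in> Linf_space \<Omega>" shows "(\<lambda>x. exp (p x)) \<in> Linf_space \<Omega>"
proof -
  obtain C where C: "AE x in lebesgue_on \<Omega>. \<bar>p x\<bar> \<le> C" and [measurable]: "p \<in> borel_measurable (lebesgue_on \<Omega>)"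
    using assms unfolding Linf_space_def by blast
  have "AE x in lebesgue_on \<Omega>. \<bar>exp (p x)\<bar> \<le> exp C"
    using C by eventually_elim simp
  moreover have "(\<lambda>x. exp (p x)) \<in> borel_measurable (lebesgue_on \<Omega>)" by measurable
  ultimately show ?thesis unfolding Linf_space_def by blast
qed

lemma Linf_L2: "p \<in> Linf_space \<Omega> \<Longrightarrow> p \<in> L2_space \<Omega>"
  using Linf_subset_L2[OF open_dom bounded_dom] by blast

lemma L2_integrable: "p \<in> L2_space \<Omega> \<Longrightarrow> integrable (lebesgue_on \<Omega>) p" for p :: "'a \<Rightarrow> real"
  by (rule L2_space_integrable[OF open_dom bounded_dom])

text \<open>The bound that makes \<open>a ln a\<close> integrable for square-integrable \<open>a\<close>.\<close>

lemma abs_mult_ln_le: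
  assumes "(0::real) \<le> a" shows "\<bar>a * ln a\<bar> \<le> a\<^sup>2 + 1"
proof (cases "a = 0")
  case False
  then have a: "a > 0" using assms by simp
  have "a * ln a \<le> a * (a - 1)" using a ln_le_minus_one[OF a] by (intro mult_left_mono) simp_all
  moreover have "ln (1 / a) \<le> 1 / a - 1" using a by (intro ln_le_minus_one) simp
  then have "a * (- ln a) \<le> a * (1 / a - 1)" using a by (intro mult_left_mono) (simp_all add: ln_div)
  moreover have "a * (1 / a - 1) = 1 - a" using a by (simp add: right_diff_distrib)
  ultimately show ?thesis using a zero_le_square[of a]
    unfolding abs_le_iff power2_eq_square right_diff_distrib by linarith
qed simp

lemma mult_ln_integrable:
  fixes a :: "'a \<Rightarrow> real"
  assumes a: "a \<in> L2_space \<Omega>" and pos: "AE x in lebesgue_on \<Omega>. 0 \<le> a x"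
  shows "integrable (lebesgue_on \<Omega>) (\<lambda>x. a x * ln (a x))"
proof (rule Bochner_Integration.integrable_bound)
  have "(\<lambda>x. 1::real) \<in> L2_space \<Omega>"
    by (rule L2_space_bounded[OF open_dom bounded_dom, of _ 1]) simp_all
  from L2_integrable[OF this] show "integrable (lebesgue_on \<Omega>) (\<lambda>x. a x * a x + 1)"
    by (intro Bochner_Integration.integrable_add L2_prod_integrable[OF a a])
  have [measurable]: "a \<in> borel_measurable (lebesgue_on \<Omega>)" using a by (simp add: L2_space_def)
  show "(\<lambda>x. a x * ln (a x)) \<in> borel_measurable (lebesgue_on \<Omega>)" by measurable
  show "AE x in lebesgue_on \<Omega>. norm (a x * ln (a x)) \<le> norm (a x * a x + 1)"
    using pos by eventually_elim (use abs_mult_ln_le in \<open>fastforce simp: power2_eq_square\<close>)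
qed

text \<open>As \<open>ln (a / e\<^sup>p) = ln a - p\<close>, only the term \<open>(a, p)\<close> couples the arguments. Where \<open>a = 0\<close> this formula
  fails but the factor \<open>a\<close> removes both sides.\<close>

lemma entropy_div_exp:
  assumes a: "a \<in> L2_space \<Omega>" and pos: "AE x in lebesgue_on \<Omega>. 0 \<le> a x" and p: "p \<in> Linf_space \<Omega>"
  shows "entropy_div \<Omega> a (\<lambda>x. exp (p x))
    = (LINT x|lebesgue_on \<Omega>. a x * ln (a x)) - L2_inner \<Omega> a p
      - (LINT x|lebesgue_on \<Omega>. a x) + (LINT x|lebesgue_on \<Omega>. exp (p x))"
proof -
  note pL = Linf_L2[OF p] and eL = Linf_L2[OF Linf_exp[OF p]]
  have [measurable]: "a \<in> borel_measurable (lebesgue_on \<Omega>)" "p \<in> borel_measurable (lebesgue_on \<Omega>)"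
    using a pL by (simp_all add: L2_space_def)
  have "entropy_div \<Omega> a (\<lambda>x. exp (p x))
      = (LINT x|lebesgue_on \<Omega>. a x * ln (a x) - a x * p x - a x + exp (p x))"
    unfolding entropy_div_def
  proof (rule integral_cong_AE)
    show "AE x in lebesgue_on \<Omega>. a x * ln (a x / exp (p x)) - a x + exp (p x)
        = a x * ln (a x) - a x * p x - a x + exp (p x)"
      using pos
    proof eventually_elim
      case (elim x)
      then show ?case
        by (cases "a x = 0") (simp_all add: ln_div right_diff_distrib)
    qed
  qed measurable
  also have "\<dots> = (LINT x|lebesgue_on \<Omega>. a x * ln (a x)) - (LINT x|lebesgue_on \<Omega>. a x * p x)
      - (LINT x|lebesgue_on \<Omega>. a x) + (LINT x|lebesgue_on \<Omega>. exp (p x))"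
    using mult_ln_integrable[OF a pos] L2_prod_integrable[OF a pL] L2_integrable[OF a] L2_integrable[OF eL]
    by simp
  finally show ?thesis by (simp add: L2_inner_def)
qed

lemma entropy_div_nonneg:
  assumes pos: "AE x in lebesgue_on \<Omega>. 0 \<le> a x"
  shows "0 \<le> entropy_div \<Omega> a (\<lambda>x. exp (p x))"
  unfolding entropy_div_def
proof (rule integral_nonneg_AE)
  show "AE x in lebesgue_on \<Omega>. 0 \<le> a x * ln (a x / exp (p x)) - a x + exp (p x)"
    using pos
  proof eventually_elim
    case (elim x)
    show ?case
    proof (cases "a x = 0")
      case False
      then have a: "a x > 0" using elim by simp
      have "ln (exp (p x) / a x) \<le> exp (p x) / a x - 1" using a by (intro ln_le_minus_one) simp
      then have "- ln (a x / exp (p x)) \<le> exp (p x) / a x - 1" using a by (simp add: ln_div)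
      then have "a x * (- ln (a x / exp (p x))) \<le> a x * (exp (p x) / a x - 1)"
        using a by (intro mult_left_mono) simp_all
      also have "\<dots> = exp (p x) - a x" using a by (simp add: right_diff_distrib)
      finally show ?thesis by simp
    qed simp
  qed
qed

text \<open>The two sides differ by \<open>D(e\<^sup>q, e\<^sup>p) \<ge> 0\<close>: the three-point identity of Bregman divergences.\<close>

lemma entropy_three_point:
  assumes a: "a \<in> L2_space \<Omega>" and pos: "AE x in lebesgue_on \<Omega>. 0 \<le> a x"
    and p: "p \<in> Linf_space \<Omega>" and q: "q \<in> Linf_space \<Omega>"
  shows "L2_inner \<Omega> (\<lambda>x. p x - q x) (\<lambda>x. exp (q x) - a x)
    \<le> entropy_div \<Omega> a (\<lambda>x. exp (p x)) - entropy_div \<Omega> a (\<lambda>x. exp (q x))"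
proof -
  note pL = Linf_L2[OF p] and qL = Linf_L2[OF q]
  note ep = Linf_L2[OF Linf_exp[OF p]] and eq = Linf_L2[OF Linf_exp[OF q]]
  note d = L2_space_diff[OF pL qL]
  have "(LINT x|lebesgue_on \<Omega>. (p x - q x) * exp (q x)) \<le> (LINT x|lebesgue_on \<Omega>. exp (p x) - exp (q x))"
  proof (rule integral_mono[OF L2_prod_integrable[OF d eq]])
    show "integrable (lebesgue_on \<Omega>) (\<lambda>x. exp (p x) - exp (q x))"
      by (rule L2_integrable[OF L2_space_diff[OF ep eq]])
    show "(p x - q x) * exp (q x) \<le> exp (p x) - exp (q x)" for x
    proof -
      have "(1 + (p x - q x)) * exp (q x) \<le> exp (p x - q x) * exp (q x)"
        by (rule mult_right_mono[OF exp_ge_add_one_self]) simp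
      also have "\<dots> = exp (p x)" by (simp flip: exp_add)
      finally show ?thesis by (simp add: distrib_right)
    qed
  qed
  then have "L2_inner \<Omega> (\<lambda>x. p x - q x) (\<lambda>x. exp (q x))
      \<le> (LINT x|lebesgue_on \<Omega>. exp (p x)) - (LINT x|lebesgue_on \<Omega>. exp (q x))"
    using L2_integrable[OF ep] L2_integrable[OF eq] by (simp add: L2_inner_def)
  moreover have "L2_inner \<Omega> (\<lambda>x. p x - q x) (\<lambda>x. exp (q x) - a x)
      = L2_inner \<Omega> (\<lambda>x. p x - q x) (\<lambda>x. exp (q x)) - (L2_inner \<Omega> a p - L2_inner \<Omega> a q)"
    unfolding L2_inner_diff_right[OF eq a d] L2_inner_commute[of \<Omega> _ a]
    unfolding L2_inner_diff_right[OF pL qL a] ..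
  ultimately show ?thesis
    unfolding entropy_div_exp[OF a pos p] entropy_div_exp[OF a pos q] by linarith
qed

section \<open>One step of the proximal iteration\<close>

lemma neg_laplacian_scaled:
  "L2_inner \<Omega> (\<lambda>x. c *\<^sub>R weak_grad \<Omega> u x) (weak_grad \<Omega> v) = c * neg_laplacian \<Omega> u v"
  unfolding neg_laplacian_def by (rule L2_inner_scaleR_left)

text \<open>The residual of the weak equation is square-integrable, so it may serve as its own test function.\<close>

lemma latent_equation_AE:
  assumes u: "u \<in> L2_space \<Omega>" and \<phi>: "\<phi> \<in> L2_space \<Omega>" and q: "q \<in> Linf_space \<Omega>"
    and eq: "\<And>w. w \<in> L2_space \<Omega> \<Longrightarrow>
       L2_inner \<Omega> u w - L2_inner \<Omega> (\<lambda>x. exp (q x)) w = L2_inner \<Omega> \<phi> w"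
  shows "AE x in lebesgue_on \<Omega>. u x = \<phi> x + exp (q x)"
proof -
  note e = Linf_L2[OF Linf_exp[OF q]]
  let ?w = "\<lambda>x. (u x - exp (q x)) - \<phi> x"
  note ue = L2_space_diff[OF u e]
  note w = L2_space_diff[OF ue \<phi>]
  have "L2_inner \<Omega> ?w ?w = 0"
    unfolding L2_inner_diff_left[OF ue \<phi> w] L2_inner_diff_left[OF u e w] using eq[OF w] by linarith
  then have "L2_norm \<Omega> ?w = 0" by (simp add: L2_norm_def)
  then have "AE x in lebesgue_on \<Omega>. ?w x = 0" using L2_norm_eq_0_iff[OF w] by blast
  then show ?thesis by eventually_elim simp
qed

lemma multiplier_equation:
  assumes f: "f \<in> L2_space \<Omega>" and p: "p \<in> L2_space \<Omega>" and q: "q \<in> L2_space \<Omega>" and v: "v \<in> H10 \<Omega>"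
    and eq: "L2_inner \<Omega> (\<lambda>x. \<alpha> *\<^sub>R weak_grad \<Omega> u x) (weak_grad \<Omega> v) + L2_inner \<Omega> q v
       = L2_inner \<Omega> (\<lambda>x. \<alpha> * f x + p x) v"
  shows "\<alpha> * (neg_laplacian \<Omega> u v - L2_inner \<Omega> f v) = L2_inner \<Omega> (\<lambda>x. p x - q x) v"
proof -
  note vL = H1_L2[OF H10_H1[OF v]]
  show ?thesis
    using eq unfolding neg_laplacian_scaled L2_inner_add_left[OF L2_space_mult[OF f] p vL]
      L2_inner_mult_left L2_inner_diff_left[OF p q vL] right_diff_distrib by linarith
qed

text \<open>Testing the step equation with \<open>u' - u = e\<^sup>q - e\<^sup>p\<close> leaves \<open>\<integral> (p - q) (e\<^sup>q - e\<^sup>p) \<le> 0\<close>, by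
  monotonicity of the exponential.\<close>

lemma proximal_step_energy_decrease:
  assumes f: "f \<in> L2_space \<Omega>" and \<alpha>: "\<alpha> > 0"
    and u: "u \<in> H1g \<Omega> g" and u': "u' \<in> H1g \<Omega> g"
    and up: "AE x in lebesgue_on \<Omega>. u x = \<phi> x + exp (p x)"
    and uq: "AE x in lebesgue_on \<Omega>. u' x = \<phi> x + exp (q x)"
    and step: "\<And>v. v \<in> H10 \<Omega> \<Longrightarrow>
      \<alpha> * (neg_laplacian \<Omega> u' v - L2_inner \<Omega> f v) = L2_inner \<Omega> (\<lambda>x. p x - q x) v"
  shows "dirichlet_energy \<Omega> f u' \<le> dirichlet_energy \<Omega> f u"
proof -
  let ?w = "\<lambda>x. u x - u' x"
  have "0 \<le> L2_inner \<Omega> (\<lambda>x. p x - q x) ?w"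
    unfolding L2_inner_def
  proof (rule integral_nonneg_AE)
    show "AE x in lebesgue_on \<Omega>. 0 \<le> (p x - q x) \<bullet> (u x - u' x)"
      using up uq
    proof eventually_elim
      case (elim x)
      then have "u x - u' x = exp (p x) - exp (q x)" by simp
      moreover have "0 \<le> (p x - q x) * (exp (p x) - exp (q x))"
        by (cases "p x \<le> q x") (simp_all add: mult_nonpos_nonpos)
      ultimately show ?case by simp
    qed
  qed
  then have "0 \<le> \<alpha> * (neg_laplacian \<Omega> u' ?w - L2_inner \<Omega> f ?w)"
    using step[OF H1g_diff_H10[OF u u']] by simp
  then have "0 \<le> neg_laplacian \<Omega> u' ?w - L2_inner \<Omega> f ?w"
    using \<alpha> by (simp only: zero_le_mult_iff) linarith
  then show ?thesis
    using dirichlet_energy_diff[OF f H1g_H1[OF u'] H1g_H1[OF u]] neg_laplacian_self_nonneg[of ?w]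
    by linarith
qed

text \<open>Convexity bounds the energy gap by the first-order term at the new iterate, which the step equation
  turns into a pairing of \<open>p - q\<close> with \<open>u' - v = e\<^sup>q - (v - \<phi>)\<close>.\<close>

lemma proximal_step_energy_gap:
  assumes f: "f \<in> L2_space \<Omega>" and \<phi>: "\<phi> \<in> L2_space \<Omega>" and \<alpha>: "\<alpha> > 0"
    and v: "v \<in> admissible \<Omega> \<phi> g" and u': "u' \<in> H1g \<Omega> g"
    and p: "p \<in> Linf_space \<Omega>" and q: "q \<in> Linf_space \<Omega>"
    and uq: "AE x in lebesgue_on \<Omega>. u' x = \<phi> x + exp (q x)"
    and step: "\<And>v. v \<in> H10 \<Omega> \<Longrightarrow>
      \<alpha> * (neg_laplacian \<Omega> u' v - L2_inner \<Omega> f v) = L2_inner \<Omega> (\<lambda>x. p x - q x) v"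
  shows "\<alpha> * (dirichlet_energy \<Omega> f u' - dirichlet_energy \<Omega> f v)
    \<le> entropy_div \<Omega> (\<lambda>x. v x - \<phi> x) (\<lambda>x. exp (p x)) - entropy_div \<Omega> (\<lambda>x. v x - \<phi> x) (\<lambda>x. exp (q x))"
proof -
  have vg: "v \<in> H1g \<Omega> g" and vphi: "AE x in lebesgue_on \<Omega>. v x \<ge> \<phi> x"
    using v by (simp_all add: admissible_def)
  note vH = H1g_H1[OF vg] and uH = H1g_H1[OF u']
  note a = L2_space_diff[OF H1_L2[OF vH] \<phi>] and eq = Linf_L2[OF Linf_exp[OF q]]
  note d = L2_space_diff[OF Linf_L2[OF p] Linf_L2[OF q]]
  let ?w = "\<lambda>x. v x - u' x"
  note wL = L2_space_diff[OF H1_L2[OF vH] H1_L2[OF uH]]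
  have pos: "AE x in lebesgue_on \<Omega>. 0 \<le> v x - \<phi> x" using vphi by eventually_elim simp
  have "\<alpha> * (dirichlet_energy \<Omega> f u' - dirichlet_energy \<Omega> f v)
      \<le> \<alpha> * (- (neg_laplacian \<Omega> u' ?w - L2_inner \<Omega> f ?w))"
    using dirichlet_energy_diff[OF f uH vH] neg_laplacian_self_nonneg[of ?w] \<alpha>
    by (intro mult_left_mono) linarith+
  also have "\<dots> = - L2_inner \<Omega> (\<lambda>x. p x - q x) ?w"
    unfolding mult_minus_right step[OF H1g_diff_H10[OF vg u']] ..
  also have "\<dots> = L2_inner \<Omega> (\<lambda>x. p x - q x) (\<lambda>x. -1 * ?w x)"
    unfolding L2_inner_mult_right by simp
  also have "\<dots> = L2_inner \<Omega> (\<lambda>x. p x - q x) (\<lambda>x. exp (q x) - (v x - \<phi> x))"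
  proof (rule L2_inner_cong[OF d d L2_space_mult[OF wL] L2_space_diff[OF eq a]])
    show "AE x in lebesgue_on \<Omega>. -1 * ?w x = exp (q x) - (v x - \<phi> x)"
      using uq by eventually_elim simp
  qed simp
  also have "\<dots> \<le> entropy_div \<Omega> (\<lambda>x. v x - \<phi> x) (\<lambda>x. exp (p x)) - entropy_div \<Omega> (\<lambda>x. v x - \<phi> x) (\<lambda>x. exp (q x))"
    by (rule entropy_three_point[OF a pos p q])
  finally show ?thesis .
qed

end

text \<open>Summing the one-step estimates telescopes the divergences; since the gaps decrease, the last
  one is below their weighted mean. Monotonicity is available from index \<open>1\<close> on, where the iterates have
  the boundary values of \<open>g\<close>; at the first step the preceding sum of weights is \<open>0\<close>.\<close>

lemma weighted_gap_telescope:
  fixes \<alpha> E D :: "nat \<Rightarrow> real"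
  assumes pos: "\<And>k. 0 < \<alpha> (Suc k)"
    and dec: "\<And>k. 1 \<le> k \<Longrightarrow> E (Suc k) \<le> E k"
    and gap: "\<And>k. \<alpha> (Suc k) * E (Suc k) \<le> D k - D (Suc k)"
  shows "(\<Sum>j=1..k. \<alpha> j) * E k \<le> D 0 - D k"
proof (induction k)
  case (Suc k)
  let ?S = "\<Sum>j=1..k. \<alpha> j"
  have "?S * E (Suc k) \<le> ?S * E k"
  proof (cases "k = 0")
    case False
    have "0 \<le> ?S"
    proof (rule sum_nonneg)
      fix j assume "j \<in> {1..k}"
      then show "0 \<le> \<alpha> j" using pos[of "j - 1"] by simp
    qed
    then show ?thesis using dec[of k] False by (intro mult_left_mono) simp_all
  qed simp
  moreover have "(\<Sum>j=1..Suc k. \<alpha> j) * E (Suc k) = ?S * E (Suc k) + \<alpha> (Suc k) * E (Suc k)"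
    by (simp add: distrib_right)
  ultimately show ?case using Suc.IH gap[of k] by linarith
qed simp

section \<open>Convergence of the proximal iteration\<close>

theorem theorem4p13:
  fixes \<Omega> :: "'a::euclidean_space set"
    and f \<phi> g ustar :: "'a \<Rightarrow> real"
    and \<alpha> :: "nat \<Rightarrow> real"
    and u \<psi> lam :: "nat \<Rightarrow> 'a \<Rightarrow> real"
    and lamstar :: "('a \<Rightarrow> real) \<Rightarrow> real"
  assumes step_pos: "\<And>k. \<alpha> (Suc k) > 0"
    and dom: "bounded_lipschitz_domain \<Omega>"
    and f: "f \<in> Linf_space \<Omega>"
    and phi: "\<phi> \<in> obstacles \<Omega>"
    and g: "g \<in> H1 \<Omega>" "continuous_on (closure \<Omega>) g"
    and boundary_gap: "(INF x\<in>frontier \<Omega>. g x - \<phi> x) > 0"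
    and psi0: "\<psi> 0 \<in> H1 \<Omega>" "\<psi> 0 \<in> Linf_space \<Omega>"
    and u0: "u 0 = (\<lambda>x. \<phi> x + exp (\<psi> 0 x))"
    and u_space: "\<And>k. u (Suc k) \<in> H1g \<Omega> g"
    and psi_space: "\<And>k. \<psi> (Suc k) \<in> Linf_space \<Omega>"
    and eq1: "\<And>k v. v \<in> H10 \<Omega> \<Longrightarrow>
       L2_inner \<Omega> (\<lambda>x. \<alpha> (Suc k) *\<^sub>R weak_grad \<Omega> (u (Suc k)) x) (weak_grad \<Omega> v) + L2_inner \<Omega> (\<psi> (Suc k)) v
       = L2_inner \<Omega> (\<lambda>x. \<alpha> (Suc k) * f x + \<psi> k x) v"
    and eq2: "\<And>k w. w \<in> L2_space \<Omega> \<Longrightarrow>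
       L2_inner \<Omega> (u (Suc k)) w - L2_inner \<Omega> (\<lambda>x. exp (\<psi> (Suc k) x)) w = L2_inner \<Omega> \<phi> w"
    and ustar: "is_arg_min (dirichlet_energy \<Omega> f) (\<lambda>v. v \<in> admissible \<Omega> \<phi> g) ustar"
    and lam: "\<And>k. lam (Suc k) = (\<lambda>x. (\<psi> k x - \<psi> (Suc k) x) / \<alpha> (Suc k))"
    and lamstar: "lamstar = (\<lambda>w. neg_laplacian \<Omega> ustar w - L2_functional \<Omega> f w)"
  shows
    "(\<forall>k\<ge>1. dirichlet_energy \<Omega> f (u (Suc k)) \<le> dirichlet_energy \<Omega> f (u k)) \<and>
     (u 0 \<in> H1g \<Omega> g \<longrightarrow> dirichlet_energy \<Omega> f (u 1) \<le> dirichlet_energy \<Omega> f (u 0)) \<and>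
     lamstar \<in> Hm1 \<Omega> \<and>
     (\<forall>k\<ge>1. L2_functional \<Omega> (lam k) \<in> Hm1 \<Omega>) \<and>
     (filterlim (\<lambda>k. \<Sum>j=1..k. \<alpha> j) at_top sequentially \<longrightarrow>
        (\<lambda>k. H1_norm \<Omega> (\<lambda>x. u k x - ustar x)) \<longlonglongrightarrow> 0 \<and>
        (\<lambda>k. Hm1_norm \<Omega> (\<lambda>w. L2_functional \<Omega> (lam k) w - lamstar w)) \<longlonglongrightarrow> 0) \<and>
     (\<forall>k\<ge>1.
        1/2 * (Hm1_norm \<Omega> (\<lambda>w. lamstar w - L2_functional \<Omega> (lam k) w))\<^sup>2
          = 1/2 * (L2_norm \<Omega> (\<lambda>x. weak_grad \<Omega> ustar x - weak_grad \<Omega> (u k) x))\<^sup>2 \<and>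
        1/2 * (L2_norm \<Omega> (\<lambda>x. weak_grad \<Omega> ustar x - weak_grad \<Omega> (u k) x))\<^sup>2
          \<le> entropy_div \<Omega> (\<lambda>x. ustar x - \<phi> x) (\<lambda>x. u 0 x - \<phi> x) / (\<Sum>j=1..k. \<alpha> j))"
proof -
  have "open \<Omega>" "bounded \<Omega>" and ne: "\<Omega> \<noteq> {}"
    using dom by (simp_all add: bounded_lipschitz_domain_def)
  then interpret bounded_open_set \<Omega> by unfold_locales

  let ?E = "dirichlet_energy \<Omega> f"
  let ?a = "\<lambda>x. ustar x - \<phi> x"
  let ?D = "\<lambda>k. entropy_div \<Omega> ?a (\<lambda>x. exp (\<psi> k x))"
  let ?S = "\<lambda>k. \<Sum>j=1..k. \<alpha> j"
  let ?G = "\<lambda>k. L2_norm \<Omega> (\<lambda>x. weak_grad \<Omega> ustar x - weak_grad \<Omega> (u k) x)"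

  have fL: "f \<in> L2_space \<Omega>" by (rule Linf_L2[OF f])
  have phiL: "\<phi> \<in> L2_space \<Omega>" using phi by (simp add: obstacles_def H1_L2)
  have us: "ustar \<in> admissible \<Omega> \<phi> g" using ustar by (simp add: is_arg_min_def)
  then have usg: "ustar \<in> H1g \<Omega> g" and usphi: "AE x in lebesgue_on \<Omega>. \<phi> x \<le> ustar x"
    by (simp_all add: admissible_def)
  note usH = H1g_H1[OF usg] and uH = H1g_H1[OF u_space]
  have psi: "\<psi> k \<in> Linf_space \<Omega>" for k
    using psi0(2) psi_space by (cases k) simp_all
  note psiL = Linf_L2[OF psi]
  have upsi: "AE x in lebesgue_on \<Omega>. u k x = \<phi> x + exp (\<psi> k x)" for k
  proof (cases k)
    case 0
    then show ?thesis using u0 by simp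
  next
    case (Suc m)
    show ?thesis
      unfolding Suc by (rule latent_equation_AE[OF H1_L2[OF uH] phiL psi eq2])
  qed
  have step: "\<alpha> (Suc k) * (neg_laplacian \<Omega> (u (Suc k)) v - L2_inner \<Omega> f v)
      = L2_inner \<Omega> (\<lambda>x. \<psi> k x - \<psi> (Suc k) x) v" if "v \<in> H10 \<Omega>" for k v
    by (rule multiplier_equation[OF fL psiL psiL that eq1[OF that]])

  have decrease: "?E (u (Suc k)) \<le> ?E (u k)" if "u k \<in> H1g \<Omega> g" for k
    by (rule proximal_step_energy_decrease[OF fL step_pos that u_space upsi upsi step])
  have u_pos: "u k \<in> H1g \<Omega> g" if "k \<ge> 1" for k
    using u_space[of "k - 1"] that by simp
  have adm: "u k \<in> admissible \<Omega> \<phi> g" if "k \<ge> 1" for k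
  proof -
    have "AE x in lebesgue_on \<Omega>. \<phi> x \<le> u k x"
      using upsi[of k] by eventually_elim simp
    then show ?thesis using u_pos[OF that] by (simp add: admissible_def)
  qed

  have lamL: "lam k \<in> L2_space \<Omega>" if "k \<ge> 1" for k
  proof -
    obtain m where k: "k = Suc m" using \<open>k \<ge> 1\<close> by (cases k) simp_all
    have "(\<lambda>x. inverse (\<alpha> (Suc m)) * (\<psi> m x - \<psi> (Suc m) x)) \<in> L2_space \<Omega>"
      by (rule L2_space_mult[OF L2_space_diff[OF psiL psiL]])
    then show ?thesis unfolding k lam by (simp add: divide_inverse mult.commute)
  qed
  have lam_eq: "L2_functional \<Omega> (lam k) w = neg_laplacian \<Omega> (u k) w - L2_inner \<Omega> f w"
    if "k \<ge> 1" "w \<in> H10 \<Omega>" for k w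
  proof -
    obtain m where k: "k = Suc m" using \<open>k \<ge> 1\<close> by (cases k) simp_all
    have "L2_functional \<Omega> (lam k) w = L2_inner \<Omega> (\<lambda>x. inverse (\<alpha> (Suc m)) * (\<psi> m x - \<psi> (Suc m) x)) w"
      unfolding k lam L2_functional_def by (simp add: divide_inverse mult.commute)
    also have "\<dots> = inverse (\<alpha> (Suc m)) * (\<alpha> (Suc m) * (neg_laplacian \<Omega> (u (Suc m)) w - L2_inner \<Omega> f w))"
      unfolding L2_inner_mult_left step[OF that(2)] ..
    also have "\<dots> = neg_laplacian \<Omega> (u k) w - L2_inner \<Omega> f w"
      using step_pos[of m] unfolding k by simp
    finally show ?thesis .
  qed
  have lamstarH: "lamstar \<in> Hm1 \<Omega>"
    unfolding lamstar by (rule Hm1_diff[OF neg_laplacian_Hm1[OF usH] L2_functional_Hm1[OF fL]])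

  (* On H^1_0 the terms with f cancel, so the multiplier error is the weak Laplacian of the primal error.
     The conclusion mentions it with both signs. *)
  have err: "Hm1_norm \<Omega> (\<lambda>w. lamstar w - L2_functional \<Omega> (lam k) w) = ?G k"
    "Hm1_norm \<Omega> (\<lambda>w. L2_functional \<Omega> (lam k) w - lamstar w) = ?G k" if k: "k \<ge> 1" for k
  proof -
    note ukg = u_pos[OF k]
    note ukH = H1g_H1[OF ukg]
    have "Hm1_norm \<Omega> (\<lambda>w. lamstar w - L2_functional \<Omega> (lam k) w)
        = L2_norm \<Omega> (weak_grad \<Omega> (\<lambda>x. ustar x - u k x))"
    proof (rule Hm1_norm_eq_grad_norm[OF ne H1g_diff_H10[OF usg ukg]])
      fix w assume w: "w \<in> H10 \<Omega>"
      show "lamstar w - L2_functional \<Omega> (lam k) w = neg_laplacian \<Omega> (\<lambda>x. ustar x - u k x) w"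
        unfolding lamstar lam_eq[OF k w] neg_laplacian_commute[of "\<lambda>x. ustar x - u k x"]
          neg_laplacian_diff[OF H10_H1[OF w] usH ukH] neg_laplacian_commute[of w]
        unfolding L2_functional_def by simp
    qed
    then show "Hm1_norm \<Omega> (\<lambda>w. lamstar w - L2_functional \<Omega> (lam k) w) = ?G k"
      unfolding L2_norm_weak_grad_diff[OF usH ukH] .
    have "Hm1_norm \<Omega> (\<lambda>w. L2_functional \<Omega> (lam k) w - lamstar w)
        = L2_norm \<Omega> (weak_grad \<Omega> (\<lambda>x. u k x - ustar x))"
    proof (rule Hm1_norm_eq_grad_norm[OF ne H1g_diff_H10[OF ukg usg]])
      fix w assume w: "w \<in> H10 \<Omega>"
      show "L2_functional \<Omega> (lam k) w - lamstar w = neg_laplacian \<Omega> (\<lambda>x. u k x - ustar x) w"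
        unfolding lamstar lam_eq[OF k w] neg_laplacian_commute[of "\<lambda>x. u k x - ustar x"]
          neg_laplacian_diff[OF H10_H1[OF w] ukH usH] neg_laplacian_commute[of w]
        unfolding L2_functional_def by simp
    qed
    then show "Hm1_norm \<Omega> (\<lambda>w. L2_functional \<Omega> (lam k) w - lamstar w) = ?G k"
      unfolding L2_norm_weak_grad_diff[OF ukH usH] L2_norm_minus_commute[of \<Omega> "weak_grad \<Omega> (u k)"] .
  qed

  have Spos: "0 < ?S k" if "k \<ge> 1" for k
  proof (rule sum_pos)
    fix j assume "j \<in> {1..k}"
    then show "0 < \<alpha> j" using step_pos[of "j - 1"] by simp
  qed (use that in simp_all)
  have rate: "1/2 * (?G k)\<^sup>2 \<le> ?D 0 / ?S k" if k: "k \<ge> 1" for k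
  proof -
    have "?S k * (?E (u k) - ?E ustar) \<le> ?D 0 - ?D k"
    proof (rule weighted_gap_telescope)
      show "0 < \<alpha> (Suc k)" for k by (rule step_pos)
      show "?E (u (Suc k)) - ?E ustar \<le> ?E (u k) - ?E ustar" if "1 \<le> k" for k
        using decrease[OF u_pos[OF that]] by simp
      show "\<alpha> (Suc k) * (?E (u (Suc k)) - ?E ustar) \<le> ?D k - ?D (Suc k)" for k
        by (rule proximal_step_energy_gap[OF fL phiL step_pos us u_space psi psi upsi step])
    qed
    moreover have "0 \<le> ?D k"
    proof (rule entropy_div_nonneg)
      show "AE x in lebesgue_on \<Omega>. 0 \<le> ?a x" using usphi by eventually_elim simp
    qed
    ultimately have "(?E (u k) - ?E ustar) * ?S k \<le> ?D 0" by (subst mult.commute) linarith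
    then have "?E (u k) - ?E ustar \<le> ?D 0 / ?S k"
      using Spos[OF k] by (simp only: pos_le_divide_eq)
    moreover have "1/2 * (?G k)\<^sup>2 \<le> ?E (u k) - ?E ustar"
      using grad_error_le_energy_gap[OF fL ustar adm[OF k]]
      unfolding L2_norm_weak_grad_diff[OF H1g_H1[OF u_pos[OF k]] usH]
        L2_norm_minus_commute[of \<Omega> "weak_grad \<Omega> (u k)"] .
    ultimately show ?thesis by linarith
  qed
  have D0: "?D 0 = entropy_div \<Omega> (\<lambda>x. ustar x - \<phi> x) (\<lambda>x. u 0 x - \<phi> x)"
    by (simp add: u0)

  have conv: "(\<lambda>k. H1_norm \<Omega> (\<lambda>x. u k x - ustar x)) \<longlonglongrightarrow> 0 \<and>
        (\<lambda>k. Hm1_norm \<Omega> (\<lambda>w. L2_functional \<Omega> (lam k) w - lamstar w)) \<longlonglongrightarrow> 0"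
    if S: "filterlim ?S at_top sequentially"
  proof -
    have "(\<lambda>k. 2 * (?D 0 / ?S k)) \<longlonglongrightarrow> 2 * 0"
      by (intro tendsto_mult tendsto_const tendsto_divide_0[OF tendsto_const]
          filterlim_at_top_imp_at_infinity S)
    then have lim0: "(\<lambda>k. 2 * (?D 0 / ?S k)) \<longlonglongrightarrow> 0" by simp
    have "(\<lambda>k. (?G k)\<^sup>2) \<longlonglongrightarrow> 0"
    proof (rule Lim_null_comparison[OF _ lim0])
      show "\<forall>\<^sub>F k in sequentially. norm ((?G k)\<^sup>2) \<le> 2 * (?D 0 / ?S k)"
        using eventually_ge_at_top[of 1]
      proof eventually_elim
        case (elim k)
        show ?case
          unfolding real_norm_def abs_of_nonneg[OF zero_le_power2] using rate[OF elim] by linarith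
      qed
    qed
    then have "(\<lambda>k. sqrt ((?G k)\<^sup>2)) \<longlonglongrightarrow> sqrt 0" by (rule tendsto_real_sqrt)
    then have G: "?G \<longlonglongrightarrow> 0" by (simp add: L2_norm_nonneg)
    obtain C where C: "\<And>w. w \<in> H10 \<Omega> \<Longrightarrow> L2_norm \<Omega> w \<le> C * L2_norm \<Omega> (weak_grad \<Omega> w)"
      using poincare_H10 by blast
    have "(\<lambda>k. (C + 1) * ?G k) \<longlonglongrightarrow> (C + 1) * 0" by (intro tendsto_mult tendsto_const G)
    then have lim1: "(\<lambda>k. (C + 1) * ?G k) \<longlonglongrightarrow> 0" by simp
    have "(\<lambda>k. H1_norm \<Omega> (\<lambda>x. u k x - ustar x)) \<longlonglongrightarrow> 0"
    proof (rule Lim_null_comparison[OF _ lim1])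
      show "\<forall>\<^sub>F k in sequentially. norm (H1_norm \<Omega> (\<lambda>x. u k x - ustar x)) \<le> (C + 1) * ?G k"
        using eventually_ge_at_top[of 1]
      proof eventually_elim
        case (elim k)
        note ukg = u_pos[OF elim]
        have "H1_norm \<Omega> (\<lambda>x. u k x - ustar x) \<le> (C + 1) * L2_norm \<Omega> (weak_grad \<Omega> (\<lambda>x. u k x - ustar x))"
          using H1_norm_le_sum[of "\<lambda>x. u k x - ustar x"] C[OF H1g_diff_H10[OF ukg usg]]
          unfolding distrib_right by linarith
        then show ?case
          using H1_norm_nonneg[of "\<lambda>x. u k x - ustar x"]
          unfolding L2_norm_weak_grad_diff[OF H1g_H1[OF ukg] usH]
            L2_norm_minus_commute[of \<Omega> "weak_grad \<Omega> (u k)"] real_norm_def by linarith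
      qed
    qed
    moreover have "(\<lambda>k. Hm1_norm \<Omega> (\<lambda>w. L2_functional \<Omega> (lam k) w - lamstar w)) \<longlonglongrightarrow> 0"
    proof (rule Lim_transform_eventually[OF G])
      show "\<forall>\<^sub>F k in sequentially. ?G k = Hm1_norm \<Omega> (\<lambda>w. L2_functional \<Omega> (lam k) w - lamstar w)"
        using eventually_ge_at_top[of 1] by eventually_elim (simp only: err)
    qed
    ultimately show ?thesis by blast
  qed

  show ?thesis
  proof (intro conjI allI impI)
    show "?E (u (Suc k)) \<le> ?E (u k)" if "k \<ge> 1" for k by (rule decrease[OF u_pos[OF that]])
    show "?E (u 1) \<le> ?E (u 0)" if "u 0 \<in> H1g \<Omega> g" using decrease[OF that] by simp
    show "lamstar \<in> Hm1 \<Omega>" by (rule lamstarH)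
    show "L2_functional \<Omega> (lam k) \<in> Hm1 \<Omega>" if "k \<ge> 1" for k
      by (rule L2_functional_Hm1[OF lamL[OF that]])
    show "(\<lambda>k. H1_norm \<Omega> (\<lambda>x. u k x - ustar x)) \<longlonglongrightarrow> 0" if "filterlim ?S at_top sequentially"
      using conv[OF that] by (rule conjunct1)
    show "(\<lambda>k. Hm1_norm \<Omega> (\<lambda>w. L2_functional \<Omega> (lam k) w - lamstar w)) \<longlonglongrightarrow> 0"
      if "filterlim ?S at_top sequentially"
      using conv[OF that] by (rule conjunct2)
    show "1/2 * (Hm1_norm \<Omega> (\<lambda>w. lamstar w - L2_functional \<Omega> (lam k) w))\<^sup>2 = 1/2 * (?G k)\<^sup>2"
      if "k \<ge> 1" for k
      by (simp only: err(1)[OF that])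
    show "1/2 * (?G k)\<^sup>2 \<le> entropy_div \<Omega> (\<lambda>x. ustar x - \<phi> x) (\<lambda>x. u 0 x - \<phi> x) / ?S k"
      if "k \<ge> 1" for k
      using rate[OF that] unfolding D0 .
  qed
qed

end
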